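(* Let $d\ge3$ and $2p>2d/(d-2)$ (with $p<\infty$). Then for all $u\in l^2(\mathbb{Z}^d)$ $$\|u\|_{l^{2p}(\mathbb{Z}^d)}^2=\left(\sum_{n\in\mathbb{Z}^d}|u(n)|^{2p}\right)^{1/p}\le\frac14\,(2\pi)^{d(p+1)/p}\,I_{p',d}\,\|\mathrm{D}u\|^2,$$ where $p'=p/(p-1)$ and $$I_{p',d}=\left(\int_{[0,2\pi]^d}\frac{dx}{\bigl(\sum_{j=1}^d\sin^2\frac{x_j}2\bigr)^{p'}}\right)^{1/p'}<\infty.$$
   Context: For $u\in l^2(\mathbb{Z}^d)$, $\mathrm{D}_iu(n)=u(n+e_i)-u(n)$ with $e_i$ the $i$-th unit vector, $\|\cdot\|$ without subscript is the $l^2$-norm, and $\|\mathrm{D}u\|^2=\|\nabla u\|^2=\sum_{i=1}^d\|\mathrm{D}_iu\|^2$. *)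

theory Defs
  imports "HOL-Analysis.Analysis"
begin

text \<open>
  Points of the lattice $Z^d$ are the elements of \<^typ>\<open>int ^ 'd\<close> with $d$ the
  cardinality of the index type. An infinite sum over a family that is not summable has value 0,
  so \<open>lp_norm q u\<close> is the $l^q$ norm only for \<open>u \<in> lp_space q\<close>.
\<close>

definition lp_space :: "real \<Rightarrow> ('a \<Rightarrow> complex) set" where
  "lp_space q = {u. (\<lambda>n. norm (u n) powr q) summable_on UNIV}"

definition lp_norm :: "real \<Rightarrow> ('a \<Rightarrow> complex) \<Rightarrow> real" where
  "lp_norm q u = (\<Sum>\<^sub>\<infinity>n. norm (u n) powr q) powr (1 / q)"

definition lattice_diff :: "'d::finite \<Rightarrow> (int ^ 'd \<Rightarrow> complex) \<Rightarrow> int ^ 'd \<Rightarrow> complex" where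
  "lattice_diff i u n = u (n + axis i 1) - u n"

definition grad_norm :: "(int ^ 'd::finite \<Rightarrow> complex) \<Rightarrow> real" where
  "grad_norm u = sqrt (\<Sum>i\<in>UNIV. (lp_norm 2 (lattice_diff i u))\<^sup>2)"

definition torus_cube :: "(real ^ 'd::finite) set" where
  "torus_cube = {x. \<forall>j. 0 \<le> x $ j \<and> x $ j \<le> 2 * pi}"

text \<open>
  The sum of squared sines vanishes on the cube only at its corners, a null set, so the value 0
  that division by zero gives there affects neither integrability nor the integral.
\<close>

definition symbol_integrand :: "real \<Rightarrow> real ^ 'd::finite \<Rightarrow> real" where
  "symbol_integrand q x = 1 / (\<Sum>j\<in>UNIV. (sin (x $ j / 2))\<^sup>2) powr q"

text \<open>
  As a real number this is meaningful only when \<open>symbol_integrand q\<close> is integrable over the cube.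
  The type argument fixes the dimension.
\<close>

definition I_const :: "real \<Rightarrow> 'd::finite itself \<Rightarrow> real" where
  "I_const q _ = (LINT x:(torus_cube :: (real ^ 'd) set)|lborel. symbol_integrand q x) powr (1 / q)"

end

theory Submission
  imports Defs
begin

text \<open>
  Let $f = \sum_n u(n) e^{in\cdot x}$ and $a(x) = \sum_j \sin^2(x_j/2)$, so that
  $\int a |f|^2 = \frac14 (2\pi)^d \|Du\|^2$. For a level $s > 0$ split $f$ at a frequency cutoff
  $a = t(s)$. By Cauchy-Schwarz the coefficients of the low part are at most
  $(2\pi)^{-d} (\int a|f|^2)^{1/2} (t^{p'-1} \int a^{-p'})^{1/2}$, and $t(s)$ is chosen to make this
  equal to $s/2$. If $|u(n)| > s$, the $n$-th coefficient of the high part then exceeds $s/2$, and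
  Bessel's inequality bounds the number of such $n$ by $4 s^{-2} (2\pi)^{-d} \int_{a > t(s)} |f|^2$.
  Integrating against $2p s^{2p-1} ds$ and exchanging the integrals gives
  \[ \sum_n |u(n)|^{2p} \le p' (2\pi)^{-d(p-1)} \|Du\|^{2p} \Bigl(\int a^{-p'}\Bigr)^{p-1}. \]
  The constant in the theorem is larger by a factor of order $(2\pi)^{2d}$, which absorbs $(p')^{1/p}$; this
  is why the Hausdorff-Young inequality is not needed. The argument is carried out for finitely supported $u$ and
  passes to $l^2$ by approximation.
\<close>

section \<open>Bounded orthogonal systems\<close>

lemma borel_measurable_cnj [measurable (raw)]:
  "f \<in> borel_measurable M \<Longrightarrow> (\<lambda>x. cnj (f x)) \<in> borel_measurable M"
  by (rule borel_measurable_continuous_on[where f=cnj]) (auto intro: continuous_intros)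

text \<open>The level-splitting argument uses nothing of the torus beyond these properties. The
  system is not normalised: integrating a finite synthesis against \<open>cnj (e n x)\<close>
  returns \<open>V\<close> times its \<open>n\<close>-th coefficient. For the torus,
  \<open>V\<close> is \<open>(2 * pi) ^ CARD('d)\<close>.\<close>

locale bounded_orthogonal_system = finite_measure M for M :: "'x measure" +
  fixes e :: "'n \<Rightarrow> 'x \<Rightarrow> complex" and V :: real
  assumes e_measurable [measurable]: "\<And>n. e n \<in> borel_measurable M"
    and e_bound: "\<And>n x. norm (e n x) \<le> 1"
    and V_pos: "V > 0"
    and orthogonal: "\<And>m n. (\<integral>x. e m x * cnj (e n x) \<partial>M) = (if m = n then of_real V else 0)"
begin

lemma integrable_bounded:
  fixes f :: "'x \<Rightarrow> 'b::{banach, second_countable_topology}"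
  assumes "f \<in> borel_measurable M" and "\<And>x. norm (f x) \<le> B"
  shows "integrable M f"
  using assms by (intro integrable_const_bound[where B=B]) auto

lemma integrable_mult_cnj:
  assumes [measurable]: "f \<in> borel_measurable M" and "\<And>x. norm (f x) \<le> B"
  shows "integrable M (\<lambda>x. f x * cnj (e n x))"
proof (rule integrable_bounded[where B="B * 1"])
  fix x show "norm (f x * cnj (e n x)) \<le> B * 1"
    unfolding norm_mult complex_mod_cnj
    using assms(2)[of x] e_bound[of n x] norm_ge_zero order_trans by (intro mult_mono) (auto intro: order_trans[OF norm_ge_zero])
qed measurable

lemma norm_synthesis_le:
  "norm (\<Sum>n\<in>F. c n * e n x) \<le> (\<Sum>n\<in>F. norm (c n))"
proof (rule order_trans[OF norm_sum sum_mono])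
  fix n show "norm (c n * e n x) \<le> norm (c n)"
    using mult_left_mono[OF e_bound norm_ge_zero, of "c n" n x] by (simp add: norm_mult)
qed

lemma integral_synthesis_cnj:
  fixes c :: "'n \<Rightarrow> complex"
  assumes "finite F"
  shows "(\<integral>x. (\<Sum>n\<in>F. c n * e n x) * cnj (e m x) \<partial>M) = (if m \<in> F then V * c m else 0)"
proof -
  have "(\<integral>x. (\<Sum>n\<in>F. c n * e n x) * cnj (e m x) \<partial>M) 
      = (\<integral>x. (\<Sum>n\<in>F. c n * (e n x * cnj (e m x))) \<partial>M)"
    by (simp only: sum_distrib_right mult.assoc)
  also have "\<dots> = (\<Sum>n\<in>F. \<integral>x. c n * (e n x * cnj (e m x)) \<partial>M)"
    by (intro Bochner_Integration.integral_sum integrable_mult_right integrable_mult_cnj[where B=1] e_bound) auto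
  also have "\<dots> = (\<Sum>n\<in>F. if n = m then V * c m else 0)"
    by (intro sum.cong) (auto simp: orthogonal)
  also have "\<dots> = (if m \<in> F then V * c m else 0)"
    using assms by simp
  finally show ?thesis .
qed

lemma integral_mult_cnj_synthesis:
  assumes "finite F" and [measurable]: "g \<in> borel_measurable M" and "\<And>x. norm (g x) \<le> B"
  shows "(\<integral>x. g x * cnj (\<Sum>n\<in>F. c n * e n x) \<partial>M) = (\<Sum>n\<in>F. cnj (c n) * (\<integral>x. g x * cnj (e n x) \<partial>M))"
proof -
  have "(\<integral>x. g x * cnj (\<Sum>n\<in>F. c n * e n x) \<partial>M) 
      = (\<integral>x. (\<Sum>n\<in>F. cnj (c n) * (g x * cnj (e n x))) \<partial>M)"
    by (simp add: cnj_sum sum_distrib_left mult_ac)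
  also have "\<dots> = (\<Sum>n\<in>F. \<integral>x. cnj (c n) * (g x * cnj (e n x)) \<partial>M)"
    by (intro Bochner_Integration.integral_sum integrable_mult_right integrable_mult_cnj[where B=B] assms)
  finally show ?thesis by simp
qed

lemma parseval:
  assumes "finite F"
  shows "(\<integral>x. (norm (\<Sum>n\<in>F. c n * e n x))\<^sup>2 \<partial>M) = V * (\<Sum>n\<in>F. (norm (c n))\<^sup>2)"
proof -
  have "complex_of_real (\<integral>x. (norm (\<Sum>n\<in>F. c n * e n x))\<^sup>2 \<partial>M)
      = (\<integral>x. complex_of_real ((norm (\<Sum>n\<in>F. c n * e n x))\<^sup>2) \<partial>M)"
    by (rule integral_complex_of_real[symmetric])
  also have "\<dots> = (\<integral>x. (\<Sum>n\<in>F. c n * e n x) * cnj (\<Sum>n\<in>F. c n * e n x) \<partial>M)"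
    by (intro Bochner_Integration.integral_cong refl) (simp only: complex_norm_square[symmetric] of_real_power)
  also have "\<dots> = (\<Sum>m\<in>F. cnj (c m) * (V * c m))"
    using assms by (subst integral_mult_cnj_synthesis[OF assms _ norm_synthesis_le])
      (auto simp: integral_synthesis_cnj)
  also have "\<dots> = complex_of_real (V * (\<Sum>n\<in>F. (norm (c n))\<^sup>2))"
    by (simp add: sum_distrib_left complex_norm_square mult_ac del: of_real_power)
  finally show ?thesis
    by (simp only: of_real_eq_iff)
qed

text \<open>Expands the nonnegative integral of \<open>(norm (g x - h x))\<^sup>2\<close>, where
  \<open>h\<close> is the orthogonal projection of \<open>g\<close> onto the span of the
  \<open>e n\<close> with \<open>n\<close> in \<open>F\<close>. The factor \<open>V\<close> on the
  right reflects the missing normalisation.\<close>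

lemma bessel:
  assumes "finite F" and [measurable]: "g \<in> borel_measurable M" and B: "\<And>x. norm (g x) \<le> B"
  shows "(\<Sum>n\<in>F. (norm (\<integral>x. g x * cnj (e n x) \<partial>M))\<^sup>2) \<le> V * (\<integral>x. (norm (g x))\<^sup>2 \<partial>M)"
proof -
  define b where "b n = (\<integral>x. g x * cnj (e n x) \<partial>M)" for n
  \<comment> \<open>Dividing by \<open>V\<close> makes \<open>h\<close> the projection, so that both
    the cross term and the square norm of \<open>h\<close> come out as \<open>T / V\<close>.\<close>
  define c where "c n = b n / V" for n
  define h where "h x = (\<Sum>n\<in>F. c n * e n x)" for x
  define T where "T = (\<Sum>n\<in>F. (norm (b n))\<^sup>2)"
  have [measurable]: "h \<in> borel_measurable M"
    unfolding h_def by measurable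
  define H where "H = (\<Sum>n\<in>F. norm (c n))"
  have H: "norm (h x) \<le> H" for x
    unfolding h_def H_def by (rule norm_synthesis_le)
  have gh: "(\<integral>x. g x * cnj (h x) \<partial>M) = of_real (T / V)"
    unfolding h_def T_def by (subst integral_mult_cnj_synthesis[OF assms(1) _ B])
      (auto simp: b_def[symmetric] c_def sum_divide_distrib complex_norm_square mult_ac simp del: of_real_power)
  have hh: "(\<integral>x. (norm (h x))\<^sup>2 \<partial>M) = T / V"
    unfolding h_def T_def parseval[OF assms(1)] c_def
    using V_pos by (simp add: norm_divide power_divide sum_divide_distrib[symmetric] power2_eq_square)
  have ig: "integrable M (\<lambda>x. (norm (g x))\<^sup>2)"
    using B by (intro integrable_bounded[where B="B^2"]) (auto intro!: power_mono)
  have ih: "integrable M (\<lambda>x. (norm (h x))\<^sup>2)"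
    using H by (intro integrable_bounded[where B="H^2"]) (auto intro!: power_mono)
  have igh: "integrable M (\<lambda>x. g x * cnj (h x))"
  proof (rule integrable_bounded[where B="B * H"])
    fix x show "norm (g x * cnj (h x)) \<le> B * H"
      unfolding norm_mult complex_mod_cnj using B[of x] H[of x]
      by (intro mult_mono) (auto intro: order_trans[OF norm_ge_zero])
  qed measurable
  define r where "r x = Re (g x * cnj (h x))" for x
  have r: "integrable M r" "(\<integral>x. r x \<partial>M) = T / V"
    unfolding r_def using igh gh by (simp_all add: integral_Re del: times_complex.simps)
  have "0 \<le> (\<integral>x. (norm (g x - h x))\<^sup>2 \<partial>M)"
    by simp
  also have "\<dots> = (\<integral>x. (norm (g x))\<^sup>2 + (norm (h x))\<^sup>2 - 2 * r x \<partial>M)"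
    unfolding r_def
    by (intro Bochner_Integration.integral_cong refl)
      (simp only: cmod_power2 minus_complex.simps complex_cnj times_complex.simps, simp add: power2_eq_square algebra_simps)
  also have "\<dots> = (\<integral>x. (norm (g x))\<^sup>2 \<partial>M) + T / V - 2 * (T / V)"
    using ig ih r hh by simp
  finally have "T / V \<le> (\<integral>x. (norm (g x))\<^sup>2 \<partial>M)"
    by simp
  then show ?thesis
    using V_pos unfolding T_def b_def by (simp add: field_simps)
qed

section \<open>Counting large coefficients\<close>

text \<open>The unnormalised coefficient of \<open>f\<close> is \<open>V * u n\<close>. The part of
  \<open>f\<close> on \<open>S x \<le> s\<close> is dominated by \<open>w\<close> and hence
  contributes at most \<open>V * s / 2\<close>. If \<open>norm (u n)\<close> exceeds
  \<open>s\<close>, the part on \<open>S x > s\<close> must therefore contribute more than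
  \<open>V * s / 2\<close>, and Bessel's inequality limits how often this happens, as in Chebyshev's
  inequality.\<close>

lemma card_large_coefficients_le:
  fixes u :: "'n \<Rightarrow> complex" and w :: "'x \<Rightarrow> real"
  assumes F: "finite F" and s: "s > 0"
    and [measurable]: "S \<in> borel_measurable M"
    and f: "\<And>x. f x = (\<Sum>n\<in>F. u n * e n x)"
    and w: "integrable M w" "(\<integral>x. w x \<partial>M) \<le> V * s / 2" "\<And>x. 0 \<le> w x"
    and low: "AE x in M. S x \<le> s \<longrightarrow> norm (f x) \<le> w x"
  shows "V * s\<^sup>2 * card {n\<in>F. s < norm (u n)}
    \<le> 4 * (\<integral>x. indicator {s<..} (S x) * (norm (f x))\<^sup>2 \<partial>M)"
proof -
  define g where "g x = indicator {s<..} (S x) *\<^sub>R f x" for x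
  define h where "h x = indicator {..s} (S x) *\<^sub>R f x" for x
  define U where "U = (\<Sum>n\<in>F. norm (u n))"
  have [measurable]: "f \<in> borel_measurable M"
    unfolding f by measurable
  have [measurable]: "g \<in> borel_measurable M" "h \<in> borel_measurable M"
    unfolding g_def h_def by measurable
  have U: "norm (f x) \<le> U" for x
    unfolding f U_def by (rule norm_synthesis_le)
  have U0: "0 \<le> U"
    by (simp add: U_def sum_nonneg)
  have gU: "norm (g x) \<le> U" and hU: "norm (h x) \<le> U" for x
    using U[of x] U0 by (auto simp: g_def h_def split: split_indicator)
  have large: "V * s / 2 < norm (\<integral>x. g x * cnj (e n x) \<partial>M)" if "n \<in> F" "s < norm (u n)" for n
  proof -
    have "norm (\<integral>x. h x * cnj (e n x) \<partial>M) \<le> (\<integral>x. norm (h x * cnj (e n x)) \<partial>M)"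
      by (rule integral_norm_bound)
    also have "\<dots> \<le> (\<integral>x. w x \<partial>M)"
    proof (rule integral_mono_AE)
      show "integrable M (\<lambda>x. norm (h x * cnj (e n x)))"
        by (intro integrable_norm integrable_mult_cnj[where B=U] hU) measurable
      show "AE x in M. norm (h x * cnj (e n x)) \<le> w x"
        using low
      proof eventually_elim
        case (elim x)
        have "norm (h x * cnj (e n x)) \<le> norm (h x)"
          unfolding norm_mult complex_mod_cnj by (rule mult_left_le[OF e_bound norm_ge_zero])
        also have "norm (h x) \<le> w x"
          using elim w(3)[of x] by (auto simp: h_def split: split_indicator)
        finally show ?case .
      qed
    qed (rule w)
    finally have h_le: "norm (\<integral>x. h x * cnj (e n x) \<partial>M) \<le> V * s / 2"
      using w(2) by simp
    have "V * u n = (\<integral>x. f x * cnj (e n x) \<partial>M)"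
      unfolding f using integral_synthesis_cnj[OF F, of u n] that by simp
    also have "\<dots> = (\<integral>x. g x * cnj (e n x) + h x * cnj (e n x) \<partial>M)"
      by (intro Bochner_Integration.integral_cong) (auto simp: g_def h_def split: split_indicator)
    also have "\<dots> = (\<integral>x. g x * cnj (e n x) \<partial>M) + (\<integral>x. h x * cnj (e n x) \<partial>M)"
      by (intro Bochner_Integration.integral_add integrable_mult_cnj[where B=U] gU hU) measurable
    finally have eq: "V * u n = (\<integral>x. g x * cnj (e n x) \<partial>M) + (\<integral>x. h x * cnj (e n x) \<partial>M)" .
    have "norm (V * u n) \<le> norm (\<integral>x. g x * cnj (e n x) \<partial>M) + V * s / 2"
      unfolding eq by (rule order_trans[OF norm_triangle_ineq add_left_mono[OF h_le]])
    moreover have "V * s < norm (V * u n)"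
      using that V_pos by (simp add: norm_mult)
    ultimately show ?thesis by simp
  qed
  have "card {n\<in>F. s < norm (u n)} * (V * s / 2)\<^sup>2 = (\<Sum>n\<in>{n\<in>F. s < norm (u n)}. (V * s / 2)\<^sup>2)"
    by simp
  also have "\<dots> \<le> (\<Sum>n\<in>{n\<in>F. s < norm (u n)}. (norm (\<integral>x. g x * cnj (e n x) \<partial>M))\<^sup>2)"
    using large V_pos s by (intro sum_mono power_mono) (auto intro: less_imp_le)
  also have "\<dots> \<le> (\<Sum>n\<in>F. (norm (\<integral>x. g x * cnj (e n x) \<partial>M))\<^sup>2)"
    by (intro sum_mono2) (use F in auto)
  also have "\<dots> \<le> V * (\<integral>x. (norm (g x))\<^sup>2 \<partial>M)"
    by (rule bessel[OF F _ gU]) measurable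
  also have "(\<integral>x. (norm (g x))\<^sup>2 \<partial>M) = (\<integral>x. indicator {s<..} (S x) * (norm (f x))\<^sup>2 \<partial>M)"
    by (intro Bochner_Integration.integral_cong) (auto simp: g_def split: split_indicator)
  \<comment> \<open>Of the two factors \<open>V\<close> in the squared threshold, one cancels
    against the factor in Bessel's inequality.\<close>
  finally have "V * (V * s\<^sup>2 * card {n\<in>F. s < norm (u n)})
      \<le> V * (4 * (\<integral>x. indicator {s<..} (S x) * (norm (f x))\<^sup>2 \<partial>M))"
    by (simp add: power2_eq_square algebra_simps)
  then show ?thesis
    using V_pos by (simp only: mult_le_cancel_left_pos)
qed

end

section \<open>Integration over the levels\<close>

text \<open>The layer-cake formula at a single point. It serves twice: with exponent
  \<open>2 * p\<close> for the coefficients and with exponent \<open>2 * p - 2\<close> for the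
  cutoff function. The second exponent may be below 1, which makes the integrand singular at 0 but
  still integrable.\<close>

lemma nn_integral_powr_layer:
  fixes b r :: real
  assumes "r > 0" "b \<ge> 0"
  shows "(\<integral>\<^sup>+s. ennreal (if 0 < s \<and> s < b then r * s powr (r - 1) else 0) \<partial>lborel) = ennreal (b powr r)"
proof -
  have "((\<lambda>s. s powr (r - 1)) has_integral (b powr r / r)) {0..b}"
    using has_integral_powr_from_0[of "r - 1" b] assms by simp
  then have "((\<lambda>s. r * s powr (r - 1)) has_integral (r * (b powr r / r))) {0..b}"
    by (rule has_integral_mult_right)
  then have "(\<integral>\<^sup>+s. ennreal (indicator {0..b} s * (r * s powr (r - 1))) \<partial>lborel) = ennreal (r * (b powr r / r))"
    using assms(1) by (intro nn_integral_has_integral_lebesgue) (auto simp del: times_divide_eq_right)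
  moreover have "AE s in lborel. s \<noteq> b"
    by (rule AE_lborel_singleton)
  then have "(\<integral>\<^sup>+s. ennreal (if 0 < s \<and> s < b then r * s powr (r - 1) else 0) \<partial>lborel)
     = (\<integral>\<^sup>+s. ennreal (indicator {0..b} s * (r * s powr (r - 1))) \<partial>lborel)"
    \<comment> \<open>The integrands can differ only at \<open>s = b\<close>; at
      \<open>s = 0\<close> both vanish because \<open>0 powr (r - 1)\<close> is 0.\<close>
    by (intro nn_integral_cong_AE, eventually_elim) (auto simp: indicator_def)
  ultimately show ?thesis using assms(1) by simp
qed

context bounded_orthogonal_system
begin

text \<open>The counting bound costs a factor of order \<open>1 / s\<^sup>2\<close>, so the layer
  density \<open>s powr (2 * p - 1)\<close> becomes \<open>s powr (2 * p - 3)\<close>. Integrated up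
  to \<open>S x\<close>, this gives a constant multiple of \<open>a x\<close>, and the energy
  integral reappears. \<open>E\<close> and \<open>K\<close> are positive upper bounds rather than
  the integrals themselves, so that they can be divided by even when the energy is 0.\<close>

lemma sum_powr_le:
  fixes u :: "'n \<Rightarrow> complex" and a :: "'x \<Rightarrow> real" and p E K :: real
  assumes F: "finite F" and p: "p > 1" and E: "E > 0" and K: "K > 0"
    and f: "\<And>x. f x = (\<Sum>n\<in>F. u n * e n x)"
    and a_measurable [measurable]: "a \<in> borel_measurable M"
    and a_nonneg: "\<And>x. 0 \<le> a x" and a_bound: "\<And>x. a x \<le> A"
    and a_pos: "AE x in M. a x > 0"
    and energy: "(\<integral>x. a x * (norm (f x))\<^sup>2 \<partial>M) \<le> E"
    and weight: "integrable M (\<lambda>x. 1 / a x powr (p / (p - 1)))"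
      "(\<integral>x. 1 / a x powr (p / (p - 1)) \<partial>M) \<le> K"
  shows "(\<Sum>n\<in>F. norm (u n) powr (2 * p))
    \<le> 4 * (p / (p - 1)) / V * (4 * E * K / V\<^sup>2) powr (p - 1) * E"
proof -
  \<comment> \<open>\<open>S x \<le> s\<close> says that \<open>a x\<close> is at most the frequency cutoff belonging to the level \<open>s\<close>:
    by Cauchy-Schwarz the part of \<open>f\<close> below it has coefficients at most \<open>s / 2\<close>.\<close>
  define S where "S x = 2 / V * sqrt (E * K) * a x powr (1 / (2 * (p - 1)))" for x
  define h where "h x = 1 / a x powr (p / (p - 1))" for x
  define U where "U = (\<Sum>n\<in>F. norm (u n))"
  have [measurable]: "f \<in> borel_measurable M"
    unfolding f by measurable
  have [measurable]: "S \<in> borel_measurable M"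
    unfolding S_def by measurable
  have h: "integrable M h" "(\<integral>x. h x \<partial>M) \<le> K"
    unfolding h_def by (fact weight)+
  have S_nonneg: "0 \<le> S x" for x
    unfolding S_def using V_pos E K by simp
  have U: "norm (f x) \<le> U" for x
    unfolding f U_def by (rule norm_synthesis_le)
  have f2: "(norm (f x))\<^sup>2 \<le> U\<^sup>2" for x
    using U by (intro power_mono) auto
  have int_af: "integrable M (\<lambda>x. a x * (norm (f x))\<^sup>2)"
  proof (rule integrable_bounded[where B="A * U\<^sup>2"])
    fix x show "norm (a x * (norm (f x))\<^sup>2) \<le> A * U\<^sup>2"
      using a_nonneg[of x] a_bound[of x] f2[of x] by (auto simp: abs_mult intro!: mult_mono)
  qed measurable
  have card_le: "V * s\<^sup>2 * card {n\<in>F. s < norm (u n)}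
      \<le> 4 * (\<integral>x. indicator {s<..} (S x) * (norm (f x))\<^sup>2 \<partial>M)" if s: "s > 0" for s
  proof (rule card_large_coefficients_le[OF F s _ f])
    \<comment> \<open>Cauchy-Schwarz in pointwise form: the product of the square roots of the two
      normalised densities is replaced by their mean. Each density has integral at most 1, so the
      prefactor \<open>V * s / 4\<close> yields the required \<open>V * s / 2\<close>.\<close>
    define w where "w x = V * s / 4 * (a x * (norm (f x))\<^sup>2 / E + h x / K)" for x
    show "integrable M w"
      unfolding w_def using int_af h(1)
      by (intro integrable_mult_right Bochner_Integration.integrable_add integrable_divide)
    have "(\<integral>x. w x \<partial>M) = V * s / 4 * ((\<integral>x. a x * (norm (f x))\<^sup>2 \<partial>M) / E + (\<integral>x. h x \<partial>M) / K)"
      unfolding w_def using int_af h(1) by simp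
    also have "\<dots> \<le> V * s / 4 * (1 + 1)"
      using energy h(2) E K V_pos s by (intro mult_left_mono add_mono) auto
    finally show "(\<integral>x. w x \<partial>M) \<le> V * s / 2"
      by simp
    show "0 \<le> w x" for x
      unfolding w_def h_def using a_nonneg[of x] V_pos s E K by simp
    show "AE x in M. S x \<le> s \<longrightarrow> norm (f x) \<le> w x"
      using a_pos
    proof (eventually_elim, intro impI)
      fix x assume ax: "0 < a x" and Sx: "S x \<le> s"
      define y where "y = norm (f x)"
      define P where "P = a x * y\<^sup>2 / E"
      define R where "R = h x / K"
      have PR: "0 \<le> P" "0 \<le> R"
        unfolding P_def R_def h_def using ax E K by simp_all
      have "(S x)\<^sup>2 \<le> s\<^sup>2"
        using Sx S_nonneg by (intro power_mono)
      also have "(S x)\<^sup>2 = 4 * E * K / V\<^sup>2 * a x powr (1 / (p - 1))"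
      proof -
        have "(a x powr (1 / (2 * (p - 1))))\<^sup>2 = a x powr (1 / (p - 1))"
          unfolding power2_eq_square powr_add[symmetric] by (rule arg_cong) (simp add: field_split_simps)
        then show ?thesis
          unfolding S_def power_mult_distrib power_divide using E K by simp
      qed
      finally have Ss: "4 * E * K / V\<^sup>2 * a x powr (1 / (p - 1)) \<le> s\<^sup>2" .
      \<comment> \<open>The conjugate exponent equals \<open>1 + 1 / (p - 1)\<close>, so all powers
        of \<open>a x\<close> cancel.\<close>
      have "a x * h x * a x powr (1 / (p - 1)) = a x powr (1 - p / (p - 1) + 1 / (p - 1))"
        unfolding h_def using ax by (simp add: powr_diff powr_add)
      also have "1 - p / (p - 1) + 1 / (p - 1) = 0"
        using p by (simp add: field_simps)
      finally have ah: "a x * h x * a x powr (1 / (p - 1)) = 1"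
        using ax by simp
      \<comment> \<open>Inserting this factor 1 produces the product \<open>P * R\<close> and the
        square of \<open>S x\<close>; the latter is at most \<open>s\<^sup>2\<close>, and
        \<open>4 * P * R\<close> is at most \<open>(P + R)\<^sup>2\<close>.\<close>
      have "16 * y\<^sup>2 = 16 * y\<^sup>2 * (a x * h x * a x powr (1 / (p - 1)))"
        using ah by simp
      also have "\<dots> = 4 * V\<^sup>2 * P * R * (4 * E * K / V\<^sup>2 * a x powr (1 / (p - 1)))"
        unfolding P_def R_def using E K V_pos by (simp add: field_simps)
      also have "\<dots> \<le> 4 * V\<^sup>2 * P * R * s\<^sup>2"
        using Ss PR by (intro mult_left_mono) simp_all
      also have "\<dots> \<le> V\<^sup>2 * s\<^sup>2 * (P + R)\<^sup>2"
      proof -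
        have "4 * P * R \<le> (P + R)\<^sup>2"
          using zero_le_power2[of "P - R"] by (simp add: power2_eq_square algebra_simps)
        then have "V\<^sup>2 * s\<^sup>2 * (4 * P * R) \<le> V\<^sup>2 * s\<^sup>2 * (P + R)\<^sup>2"
          by (rule mult_left_mono) simp
        then show ?thesis
          by (simp add: mult_ac)
      qed
      finally have "(4 * y)\<^sup>2 \<le> (V * s * (P + R))\<^sup>2"
        by (simp add: power_mult_distrib)
      then have "4 * y \<le> V * s * (P + R)"
        by (rule power2_le_imp_le) (use PR V_pos s in simp)
      then show "norm (f x) \<le> w x"
        unfolding w_def P_def R_def y_def by simp
    qed
  qed measurable
  \<comment> \<open>\<open>r - 1\<close> is the power of \<open>s\<close> that is left after the
    counting bound. \<open>C\<close> is chosen so that \<open>2 * p\<close> times the factor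
    \<open>4 / V\<close> of that bound equals \<open>C * r\<close>, with \<open>r\<close> reserved
    for the layer formula.\<close>
  define r where "r = 2 * p - 2"
  have r: "r > 0"
    using p by (simp add: r_def)
  define C where "C = 8 * p / (V * r)"
  have C: "0 \<le> C"
    unfolding C_def using p r V_pos by simp
  have int_f: "integrable M (\<lambda>x. indicator {s<..} (S x) * (norm (f x))\<^sup>2)" for s
    using f2 by (intro integrable_bounded[where B="U\<^sup>2"]) (auto simp: indicator_def)
  have "ennreal (\<Sum>n\<in>F. norm (u n) powr (2 * p))
      = (\<Sum>n\<in>F. \<integral>\<^sup>+s. ennreal (if 0 < s \<and> s < norm (u n) then 2 * p * s powr (2 * p - 1) else 0) \<partial>lborel)"
    using p by (subst nn_integral_powr_layer) simp_all
  also have "\<dots> = (\<integral>\<^sup>+s. (\<Sum>n\<in>F. ennreal (if 0 < s \<and> s < norm (u n) then 2 * p * s powr (2 * p - 1) else 0)) \<partial>lborel)"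
    by (subst nn_integral_sum) auto
  also have "\<dots> \<le> (\<integral>\<^sup>+s. (\<integral>\<^sup>+x. ennreal (C * (norm (f x))\<^sup>2) * ennreal (if 0 < s \<and> s < S x then r * s powr (r - 1) else 0) \<partial>M) \<partial>lborel)"
  proof (intro nn_integral_mono)
    fix s :: real
    show "(\<Sum>n\<in>F. ennreal (if 0 < s \<and> s < norm (u n) then 2 * p * s powr (2 * p - 1) else 0))
      \<le> (\<integral>\<^sup>+x. ennreal (C * (norm (f x))\<^sup>2) * ennreal (if 0 < s \<and> s < S x then r * s powr (r - 1) else 0) \<partial>M)"
    proof (cases "s > 0")
      case s: True
      define c where "c = 2 * p * s powr (2 * p - 1)"
      define d where "d = r * s powr (r - 1)"
      have d: "0 \<le> d"
        unfolding d_def using r by simp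
      have cd: "c = C * d * (V * s\<^sup>2) / 4"
      proof -
        have "s powr (2 * p - 1) = s powr (r - 1) * s\<^sup>2"
          using s by (simp add: r_def powr_add[symmetric] flip: powr_numeral)
        then show ?thesis
          unfolding c_def C_def d_def using V_pos r by simp
      qed
      have "(\<Sum>n\<in>F. ennreal (if 0 < s \<and> s < norm (u n) then c else 0))
          = ennreal (\<Sum>n\<in>F. if s < norm (u n) then c else 0)"
        using s p by (subst sum_ennreal[symmetric]) (auto simp: c_def)
      also have "(\<Sum>n\<in>F. if s < norm (u n) then c else 0) = card {n\<in>F. s < norm (u n)} * c"
        using F by (simp add: sum.If_cases Int_def)
      also have "\<dots> = C * d * (V * s\<^sup>2 * card {n\<in>F. s < norm (u n)}) / 4"
        unfolding cd by simp
      also have "\<dots> \<le> C * d * (4 * (\<integral>x. indicator {s<..} (S x) * (norm (f x))\<^sup>2 \<partial>M)) / 4"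
        using card_le[OF s] C d by (intro divide_right_mono mult_left_mono) auto
      also have "\<dots> = (\<integral>x. C * d * (indicator {s<..} (S x) * (norm (f x))\<^sup>2) \<partial>M)"
        by simp
      also have "ennreal \<dots> = (\<integral>\<^sup>+x. ennreal (C * d * (indicator {s<..} (S x) * (norm (f x))\<^sup>2)) \<partial>M)"
        using C d int_f by (intro nn_integral_eq_integral[symmetric]) auto
      also have "\<dots> = (\<integral>\<^sup>+x. ennreal (C * (norm (f x))\<^sup>2) * ennreal (if 0 < s \<and> s < S x then d else 0) \<partial>M)"
        using s C d by (intro nn_integral_cong) (auto simp: indicator_def ennreal_mult[symmetric] mult_ac)
      finally show ?thesis
        unfolding c_def d_def by (simp add: ennreal_leI)
    qed simp
  qed
  \<comment> \<open>Tonelli's theorem: with nonnegative extended values the exchange asks only for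
    measurability.\<close>
  also have "\<dots> = (\<integral>\<^sup>+x. (\<integral>\<^sup>+s. ennreal (C * (norm (f x))\<^sup>2) * ennreal (if 0 < s \<and> s < S x then r * s powr (r - 1) else 0) \<partial>lborel) \<partial>M)"
  proof -
    interpret pair_sigma_finite M "lborel :: real measure" ..
    show ?thesis by (rule Fubini') measurable
  qed
  also have "\<dots> = (\<integral>\<^sup>+x. ennreal (C * (norm (f x))\<^sup>2) * ennreal (S x powr r) \<partial>M)"
    using r S_nonneg by (simp add: nn_integral_cmult nn_integral_powr_layer)
  also have "\<dots> = (\<integral>\<^sup>+x. ennreal (C * (4 * E * K / V\<^sup>2) powr (p - 1) * (a x * (norm (f x))\<^sup>2)) \<partial>M)"
  proof (rule nn_integral_cong)
    fix x
    have "S x powr r = (2 / V * sqrt (E * K)) powr r * (a x powr (1 / (2 * (p - 1)))) powr r"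
      unfolding S_def by (rule powr_mult)
    \<comment> \<open>The exponent in \<open>S\<close> is the reciprocal of \<open>r\<close>, so
      exactly the first power of \<open>a x\<close> survives.\<close>
    also have "(a x powr (1 / (2 * (p - 1)))) powr r = a x"
      using p a_nonneg[of x] by (simp add: powr_powr r_def)
    also have "(2 / V * sqrt (E * K)) powr r = ((2 / V * sqrt (E * K)) powr 2) powr (p - 1)"
      unfolding powr_powr r_def by (simp add: algebra_simps)
    also have "(2 / V * sqrt (E * K)) powr 2 = 4 * E * K / V\<^sup>2"
      using V_pos E K by (simp add: power_mult_distrib power_divide)
    finally show "ennreal (C * (norm (f x))\<^sup>2) * ennreal (S x powr r)
        = ennreal (C * (4 * E * K / V\<^sup>2) powr (p - 1) * (a x * (norm (f x))\<^sup>2))"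
      using C a_nonneg[of x] by (simp add: ennreal_mult[symmetric] mult_ac)
  qed
  also have "\<dots> = ennreal (\<integral>x. C * (4 * E * K / V\<^sup>2) powr (p - 1) * (a x * (norm (f x))\<^sup>2) \<partial>M)"
    using C a_nonneg int_af by (intro nn_integral_eq_integral) auto
  also have "\<dots> = ennreal (C * (4 * E * K / V\<^sup>2) powr (p - 1) * (\<integral>x. a x * (norm (f x))\<^sup>2 \<partial>M))"
    by simp
  also have "\<dots> \<le> ennreal (C * (4 * E * K / V\<^sup>2) powr (p - 1) * E)"
    using energy C by (intro ennreal_leI mult_left_mono) auto
  finally have "(\<Sum>n\<in>F. norm (u n) powr (2 * p)) \<le> C * (4 * E * K / V\<^sup>2) powr (p - 1) * E"
    using C E by (simp add: ennreal_le_iff)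
  also have "C = 4 * (p / (p - 1)) / V"
    unfolding C_def r_def using V_pos p by (simp add: field_simps)
  finally show ?thesis .
qed

end

section \<open>Characters of the torus\<close>

text \<open>Lebesgue measure is the image of a product measure under the coordinate map, and on the
  product Fubini's theorem applies factor by factor.\<close>

lemma lborel_integral_prod_Basis:
  fixes f :: "'a::euclidean_space \<Rightarrow> real \<Rightarrow> 'b::{real_normed_field, banach, second_countable_topology}"
  assumes "\<And>b. b \<in> Basis \<Longrightarrow> integrable lborel (f b)"
  shows "(\<integral>x. (\<Prod>b\<in>Basis. f b (x \<bullet> b)) \<partial>lborel) = (\<Prod>b\<in>Basis. \<integral>t. f b t \<partial>lborel)"
proof -
  interpret product_sigma_finite "\<lambda>_::'a. lborel :: real measure" ..
  have [measurable]: "f b \<in> borel_measurable borel" if "b \<in> Basis" for b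
    using borel_measurable_integrable[OF assms[OF that]] by simp
  have "(\<integral>x. (\<Prod>b\<in>Basis. f b (x \<bullet> b)) \<partial>(lborel :: 'a measure))
      = (\<integral>y. (\<Prod>b\<in>Basis. f b (y b)) \<partial>(\<Pi>\<^sub>M b\<in>Basis. lborel))"
    by (subst lborel_eq, subst integral_distr)
      (auto intro!: Bochner_Integration.integral_cong prod.cong)
  also have "\<dots> = (\<Prod>b\<in>Basis. \<integral>t. f b t \<partial>lborel)"
    using assms by (intro product_integral_prod) auto
  finally show ?thesis .
qed

lemma bij_betw_axis_Basis: "bij_betw (\<lambda>j. axis j (1::real)) UNIV (Basis :: (real ^ 'd::finite) set)"
  unfolding bij_betw_def by (auto simp: inj_on_def axis_eq_axis Basis_vec_def)

lemma prod_Basis_cart: "(\<Prod>b\<in>(Basis :: (real ^ 'd::finite) set). g b) = (\<Prod>j\<in>UNIV. g (axis j 1))"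
  by (rule prod.reindex_bij_betw[OF bij_betw_axis_Basis, symmetric])

lemma lborel_integral_prod_cart:
  fixes f :: "'d::finite \<Rightarrow> real \<Rightarrow> 'b::{real_normed_field, banach, second_countable_topology}"
  assumes "\<And>j. integrable lborel (f j)"
  shows "(\<integral>x. (\<Prod>j\<in>UNIV. f j (x $ j)) \<partial>(lborel :: (real ^ 'd) measure)) = (\<Prod>j\<in>UNIV. \<integral>t. f j t \<partial>lborel)"
  using lborel_integral_prod_Basis[of "\<lambda>b :: real ^ 'd. f (axis_index b)"] assms
  by (simp add: prod_Basis_cart cart_eq_inner_axis[symmetric])

lemma nn_integral_lborel_prod_cart:
  fixes f :: "'d::finite \<Rightarrow> real \<Rightarrow> ennreal"
  assumes "\<And>j. f j \<in> borel_measurable borel"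
  shows "(\<integral>\<^sup>+x. (\<Prod>j\<in>UNIV. f j (x $ j)) \<partial>(lborel :: (real ^ 'd) measure)) = (\<Prod>j\<in>UNIV. \<integral>\<^sup>+t. f j t \<partial>lborel)"
  using nn_integral_lborel_prod[of "\<lambda>b :: real ^ 'd. f (axis_index b)"] assms
  by (simp add: prod_Basis_cart cart_eq_inner_axis[symmetric])

lemma integrable_cis_Icc:
  "integrable lborel (\<lambda>t. indicator {0..2 * pi} t *\<^sub>R cis (of_int k * t))"
  using borel_integrable_atLeastAtMost'[of 0 "2 * pi" "\<lambda>t. cis (of_int k * t)"]
  by (simp add: set_integrable_def continuous_intros)

lemma integral_cis_Icc:
  "(\<integral>t. indicator {0..2 * pi} t *\<^sub>R cis (of_int k * t) \<partial>lborel) = (if k = 0 then complex_of_real (2 * pi) else 0)"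
proof (cases "k = 0")
  case False
  define F where "F t = cis (of_int k * t) / (\<i> * of_int k)" for t
  have "(\<integral>t. indicator {0..2 * pi} t *\<^sub>R cis (of_int k * t) \<partial>lborel) = F (2 * pi) - F 0"
  proof (rule integral_FTC_Icc)
    fix x :: real
    have "((\<lambda>z. exp (\<i> * of_int k * z) / (\<i> * of_int k)) has_field_derivative
        exp (\<i> * of_int k * of_real x)) (at (of_real x))"
      using False by (auto intro!: derivative_eq_intros)
    then have "((\<lambda>t. exp (\<i> * of_int k * of_real t) / (\<i> * of_int k)) has_vector_derivative
        exp (\<i> * of_int k * of_real x)) (at x within {0..2 * pi})"
      by (rule has_vector_derivative_real_field)
    then show "(F has_vector_derivative cis (of_int k * x)) (at x within {0..2 * pi})"
      by (simp add: F_def[abs_def] cis_conv_exp mult.assoc)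
  qed (auto intro!: continuous_intros)
  also have "F (2 * pi) = F 0"
    using cis_multiple_2pi[of "of_int k"] by (simp add: F_def mult_ac)
  finally show ?thesis using False by simp
qed (simp add: scaleR_conv_of_real)

text \<open>Lets integrals over the cube factor into integrals over intervals.\<close>

lemma indicator_torus_cube:
  "indicator torus_cube x = (\<Prod>j\<in>UNIV. indicator {0..2 * pi} (x $ j) :: 'b::linordered_idom)"
proof (cases "x \<in> torus_cube")
  case False
  then obtain j where "\<not> (0 \<le> x $ j \<and> x $ j \<le> 2 * pi)"
    by (auto simp: torus_cube_def)
  then have "(\<Prod>j\<in>UNIV. indicator {0..2 * pi} (x $ j) :: 'b) = 0"
    by (intro prod_zero) (auto simp: indicator_def)
  then show ?thesis using False by simp
qed (auto simp: torus_cube_def indicator_def)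

lemma torus_cube_eq_cbox: "(torus_cube :: (real ^ 'd::finite) set) = cbox 0 (\<chi> j. 2 * pi)"
  by (auto simp: torus_cube_def mem_box_cart)

lemma torus_cube_measurable [measurable]: "(torus_cube :: (real ^ 'd::finite) set) \<in> sets borel"
  by (simp add: torus_cube_eq_cbox)

text \<open>Restricting the space yields the finite measure that the locale demands. The closed cube
  contains opposite faces, which coincide on the torus; they are null sets.\<close>

definition torus_measure :: "(real ^ 'd::finite) measure" where
  "torus_measure = restrict_space lborel torus_cube"

definition torus_character :: "int ^ 'd::finite \<Rightarrow> real ^ 'd \<Rightarrow> complex" where
  "torus_character n x = cis (\<Sum>j\<in>UNIV. of_int (n $ j) * x $ j)"

lemma vec_nth_measurable [measurable]: "(\<lambda>x :: real ^ 'd::finite. x $ j) \<in> borel_measurable borel"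
  by (rule borel_measurable_continuous_onI) (intro continuous_intros)

lemma torus_measurableI: "f \<in> borel_measurable borel \<Longrightarrow> f \<in> borel_measurable torus_measure"
  unfolding torus_measure_def by (intro measurable_restrict_space1) simp

lemma torus_character_measurable [measurable]: "torus_character n \<in> borel_measurable borel"
  unfolding torus_character_def by (rule borel_measurable_continuous_onI) (intro continuous_intros)

lemma torus_character_cnj: "torus_character m x * cnj (torus_character n x) = torus_character (m - n) x"
  unfolding torus_character_def
  by (simp add: cis_cnj cis_mult sum_subtractf left_diff_distrib)

text \<open>The integral factors over the coordinates, and a single nonzero frequency already makes
  its factor vanish.\<close>

lemma integral_torus_character:
  "(\<integral>x. torus_character n x \<partial>(torus_measure :: (real ^ 'd) measure))
    = (if n = (0 :: int ^ 'd::finite) then of_real ((2 * pi) ^ CARD('d)) else 0)"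
proof -
  have "(\<integral>x. torus_character n x \<partial>(torus_measure :: (real ^ 'd) measure))
      = (\<integral>x. indicator torus_cube x *\<^sub>R torus_character n x \<partial>lborel)"
    unfolding torus_measure_def by (subst integral_restrict_space) auto
  also have "\<dots> = (\<integral>x. (\<Prod>j\<in>UNIV. indicator {0..2 * pi} (x $ j) *\<^sub>R cis (of_int (n $ j) * x $ j)) \<partial>lborel)"
    unfolding torus_character_def indicator_torus_cube
    by (simp add: scaleR_conv_of_real prod.distrib cis_conv_exp exp_sum sum_distrib_left)
  also have "\<dots> = (\<Prod>j\<in>UNIV. if n $ j = 0 then complex_of_real (2 * pi) else 0)"
    by (subst lborel_integral_prod_cart[OF integrable_cis_Icc]) (simp only: integral_cis_Icc)
  also have "\<dots> = (if n = 0 then of_real ((2 * pi) ^ CARD('d)) else 0)"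
    by (auto simp: vec_eq_iff)
  finally show ?thesis .
qed

section \<open>Integrability of negative powers of the symbol\<close>

text \<open>Jordan's inequality, squared: by concavity the sine lies above its chord on the interval
  from 0 to \<open>pi / 2\<close>.\<close>

lemma sin_half_sq_ge:
  assumes "0 \<le> t" "t \<le> pi"
  shows "(t / pi)\<^sup>2 \<le> (sin (t / 2))\<^sup>2"
proof (intro power_mono)
  have conc: "concave_on {0..pi / 2} sin"
  proof (rule f''_le0_imp_concave)
    show "DERIV sin x :> cos x" "DERIV cos x :> - sin x" for x :: real
      by (auto intro!: derivative_eq_intros)
    show "- sin x \<le> 0" if "x \<in> {0..pi / 2}" for x
      using that sin_ge_zero[of x] by simp
  qed simp
  have "(1 - t / pi) * sin 0 + t / pi * sin (pi / 2) \<le> sin ((1 - t / pi) *\<^sub>R 0 + (t / pi) *\<^sub>R (pi / 2))"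
    using concave_onD[OF conc, of "t / pi" 0 "pi / 2"] assms by simp
  then show "t / pi \<le> sin (t / 2)"
    by simp
qed (use assms in simp)

text \<open>Near both endpoints the integrand has a singularity of order \<open>2 * \<beta>\<close>,
  which is less than 1. Jordan's inequality controls the left half of the interval, and reflection
  at \<open>pi\<close> carries the bound to the right half.\<close>

lemma nn_integral_sin_powr_finite:
  assumes "0 < \<beta>" "\<beta> < 1 / 2"
  shows "(\<integral>\<^sup>+t. ennreal (indicator {0..2 * pi} t * ((sin (t / 2))\<^sup>2) powr - \<beta>) \<partial>lborel) < \<infinity>"
proof -
  define w where "w t = ennreal (indicator {0..pi} t * (pi powr (2 * \<beta>) * t powr (- 2 * \<beta>)))" for t
  have [measurable]: "w \<in> borel_measurable borel"
    unfolding w_def by measurable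
  have "((\<lambda>t. pi powr (2 * \<beta>) * t powr (- 2 * \<beta>)) has_integral
      pi powr (2 * \<beta>) * (pi powr (- 2 * \<beta> + 1) / (- 2 * \<beta> + 1))) {0..pi}"
    using assms by (intro has_integral_mult_right has_integral_powr_from_0) auto
  then have "(\<integral>\<^sup>+t. w t \<partial>lborel) = ennreal (pi powr (2 * \<beta>) * (pi powr (- 2 * \<beta> + 1) / (- 2 * \<beta> + 1)))"
    unfolding w_def by (intro nn_integral_has_integral_lebesgue) auto
  then have fin: "(\<integral>\<^sup>+t. w t \<partial>lborel) < \<infinity>"
    by simp
  have bound: "((sin (t / 2))\<^sup>2) powr - \<beta> \<le> pi powr (2 * \<beta>) * t powr (- 2 * \<beta>)" if "0 < t" "t \<le> pi" for t
  proof -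
    have "((sin (t / 2))\<^sup>2) powr - \<beta> \<le> ((t / pi)\<^sup>2) powr - \<beta>"
      using that assms sin_half_sq_ge[of t] by (intro powr_mono2') auto
    also have "\<dots> = (t / pi) powr (- 2 * \<beta>)"
      using that by (simp add: powr_powr flip: powr_numeral)
    also have "\<dots> = pi powr (2 * \<beta>) * t powr (- 2 * \<beta>)"
      using that by (simp add: powr_divide powr_minus field_simps)
    finally show ?thesis .
  qed
  have "(\<integral>\<^sup>+t. ennreal (indicator {0..2 * pi} t * ((sin (t / 2))\<^sup>2) powr - \<beta>) \<partial>lborel)
      \<le> (\<integral>\<^sup>+t. w t + w (2 * pi + - 1 * t) \<partial>lborel)"
  proof (rule nn_integral_mono)
    fix t :: real
    \<comment> \<open>At the endpoints the sine vanishes and \<open>0 powr - \<beta>\<close> is 0,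
      so only the first two cases have content.\<close>
    consider "0 < t" "t \<le> pi" | "pi < t" "t < 2 * pi" | "t = 0" | "t = 2 * pi" | "t < 0" | "2 * pi < t"
      by linarith
    then show "ennreal (indicator {0..2 * pi} t * ((sin (t / 2))\<^sup>2) powr - \<beta>) \<le> w t + w (2 * pi + - 1 * t)"
    proof cases
      case 1
      then have "ennreal (indicator {0..2 * pi} t * ((sin (t / 2))\<^sup>2) powr - \<beta>) \<le> w t"
        using bound[of t] unfolding w_def by (intro ennreal_leI) (simp add: indicator_def)
      then show ?thesis
        by (rule order_trans) simp
    next
      case 2
      have "sin ((2 * pi - t) / 2) = sin (t / 2)"
        using sin_pi_minus[of "t / 2"] by (simp add: diff_divide_distrib)
      then have "ennreal (indicator {0..2 * pi} t * ((sin (t / 2))\<^sup>2) powr - \<beta>) \<le> w (2 * pi + - 1 * t)"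
        using bound[of "2 * pi - t"] 2 unfolding w_def by (intro ennreal_leI) (simp add: indicator_def)
      then show ?thesis
        by (rule order_trans) simp
    qed (simp_all add: indicator_def)
  qed
  also have "\<dots> = (\<integral>\<^sup>+t. w t \<partial>lborel) + (\<integral>\<^sup>+t. w (2 * pi + - 1 * t) \<partial>lborel)"
    by (rule nn_integral_add) measurable
  also have "(\<integral>\<^sup>+t. w (2 * pi + - 1 * t) \<partial>lborel) = (\<integral>\<^sup>+t. w t \<partial>lborel)"
    using nn_integral_real_affine[of w "-1" "2 * pi"] by simp
  finally show ?thesis
    using fin by (simp add: order_le_less_trans)
qed

lemma AE_vec_nth_neq:
  fixes c :: real
  shows "AE x in (lborel :: (real ^ 'd::finite) measure). \<forall>j. x $ j \<noteq> c"
proof (rule eventually_all_finite)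
  fix j :: 'd
  have "negligible {x :: real ^ 'd. x \<bullet> axis j 1 = c}"
    by (rule negligible_standard_hyperplane) (simp add: axis_in_Basis_iff)
  then have "{x :: real ^ 'd. x $ j = c} \<in> null_sets lebesgue"
    by (simp add: negligible_iff_null_sets cart_eq_inner_axis)
  moreover have "{x :: real ^ 'd. x $ j = c} \<in> sets lborel"
    by simp measurable
  ultimately have "{x :: real ^ 'd. x $ j = c} \<in> null_sets lborel"
    by (simp add: null_sets_completion_iff)
  then show "AE x in (lborel :: (real ^ 'd) measure). x $ j \<noteq> c"
    by (rule AE_I') auto
qed

text \<open>A quarter of the Fourier symbol of the negative lattice Laplacian; this is the function
  \<open>a\<close> of the overview.\<close>

definition sin_symbol :: "real ^ 'd::finite \<Rightarrow> real" where
  "sin_symbol x = (\<Sum>j\<in>UNIV. (sin (x $ j / 2))\<^sup>2)"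

lemma sin_symbol_measurable [measurable]: "sin_symbol \<in> borel_measurable borel"
  unfolding sin_symbol_def by measurable

lemma sin_half_neq_0:
  assumes "0 < t" "t < 2 * pi"
  shows "sin (t / 2) \<noteq> (0::real)"
  using assms sin_gt_zero[of "t / 2"] by simp

text \<open>The symbol is at least each of its summands. Distributing the exponent \<open>q\<close>
  equally over the coordinates therefore bounds the integrand by a product of one-dimensional ones
  with exponent \<open>\<beta> = q / CARD('d)\<close>, and \<open>q < CARD('d) / 2\<close> says that
  \<open>\<beta> < 1 / 2\<close>.\<close>

lemma set_integrable_symbol_integrand:
  fixes q :: real
  assumes q: "0 < q" "q < CARD('d::finite) / 2"
  shows "set_integrable lborel (torus_cube :: (real ^ 'd) set) (symbol_integrand q)"
  unfolding set_integrable_def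
proof (rule integrableI_bounded)
  show "(\<lambda>x :: real ^ 'd. indicator torus_cube x *\<^sub>R symbol_integrand q x) \<in> borel_measurable lborel"
    unfolding symbol_integrand_def by measurable
  define \<beta> where "\<beta> = q / CARD('d)"
  have \<beta>: "0 < \<beta>" "\<beta> < 1 / 2"
    using q by (simp_all add: \<beta>_def field_simps)
  have "(\<integral>\<^sup>+x. norm (indicator torus_cube x *\<^sub>R symbol_integrand q x) \<partial>(lborel :: (real ^ 'd) measure))
      \<le> (\<integral>\<^sup>+x. (\<Prod>j\<in>UNIV. ennreal (indicator {0..2 * pi} (x $ j) * ((sin (x $ j / 2))\<^sup>2) powr - \<beta>)) \<partial>(lborel :: (real ^ 'd) measure))"
  proof (rule nn_integral_mono_AE)
    \<comment> \<open>On the faces of the cube a factor \<open>0 powr - \<beta> = 0\<close> makes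
      the product vanish, so the bound can fail there; the faces form a null set.\<close>
    show "AE x in (lborel :: (real ^ 'd) measure). ennreal (norm (indicator torus_cube x *\<^sub>R symbol_integrand q x))
        \<le> (\<Prod>j\<in>UNIV. ennreal (indicator {0..2 * pi} (x $ j) * ((sin (x $ j / 2))\<^sup>2) powr - \<beta>))"
      using AE_vec_nth_neq[of 0] AE_vec_nth_neq[of "2 * pi"]
    proof eventually_elim
      fix x :: "real ^ 'd"
      assume x: "\<forall>j. x $ j \<noteq> 0" "\<forall>j. x $ j \<noteq> 2 * pi"
      show "ennreal (norm (indicator torus_cube x *\<^sub>R symbol_integrand q x))
        \<le> (\<Prod>j\<in>UNIV. ennreal (indicator {0..2 * pi} (x $ j) * ((sin (x $ j / 2))\<^sup>2) powr - \<beta>))"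
      proof (cases "x \<in> torus_cube")
        case True
        then have xj: "0 < x $ j" "x $ j < 2 * pi" for j
          using x by (auto simp: torus_cube_def order_less_le)
        define a where "a = (\<Sum>j\<in>UNIV. (sin (x $ j / 2))\<^sup>2)"
        have s_pos: "0 < (sin (x $ j / 2))\<^sup>2" for j
          using sin_half_neq_0[OF xj] by simp
        have s_le: "(sin (x $ j / 2))\<^sup>2 \<le> a" for j
          unfolding a_def by (rule member_le_sum) auto
        have a: "0 < a"
          using s_pos s_le order_less_le_trans by blast
        have "1 / a powr q = a powr (- \<beta> * CARD('d))"
          by (simp add: \<beta>_def powr_minus_divide)
        also have "\<dots> = (\<Prod>j\<in>(UNIV :: 'd set). a powr - \<beta>)"
          using a by (simp add: powr_realpow[symmetric] powr_powr)
        also have "\<dots> \<le> (\<Prod>j\<in>UNIV. ((sin (x $ j / 2))\<^sup>2) powr - \<beta>)"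
          using \<beta> s_pos s_le by (intro prod_mono conjI powr_mono2') auto
        finally have "ennreal (1 / a powr q) \<le> (\<Prod>j\<in>UNIV. ennreal (((sin (x $ j / 2))\<^sup>2) powr - \<beta>))"
          by (simp add: prod_ennreal ennreal_leI)
        then show ?thesis
          using True xj by (simp add: symbol_integrand_def a_def torus_cube_def)
      qed simp
    qed
  qed
  also have "\<dots> = (\<Prod>j\<in>(UNIV :: 'd set). \<integral>\<^sup>+t. ennreal (indicator {0..2 * pi} t * ((sin (t / 2))\<^sup>2) powr - \<beta>) \<partial>lborel)"
    by (rule nn_integral_lborel_prod_cart) measurable
  also have "\<dots> < \<infinity>"
    using nn_integral_sin_powr_finite[OF \<beta>] by (simp add: ennreal_prod_eq_top less_top[symmetric] del: prod_constant)
  finally show "(\<integral>\<^sup>+x. norm (indicator torus_cube x *\<^sub>R symbol_integrand q x) \<partial>(lborel :: (real ^ 'd) measure)) < \<infinity>" .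
qed

section \<open>The torus as a bounded orthogonal system\<close>

lemma integrable_torus_measure_iff:
  "integrable torus_measure f \<longleftrightarrow> set_integrable lborel torus_cube f"
  for f :: "real ^ 'd::finite \<Rightarrow> 'b::{banach, second_countable_topology}"
  unfolding torus_measure_def set_integrable_def by (subst integrable_restrict_space) auto

lemma integral_torus_measure:
  "integral\<^sup>L torus_measure f = (LINT x:torus_cube|lborel. f x)"
  for f :: "real ^ 'd::finite \<Rightarrow> 'b::{banach, second_countable_topology}"
  unfolding torus_measure_def set_lebesgue_integral_def by (subst integral_restrict_space) auto

interpretation torus: bounded_orthogonal_system
  "torus_measure :: (real ^ 'd::finite) measure" torus_character "(2 * pi) ^ CARD('d)"
proof (intro bounded_orthogonal_system.intro bounded_orthogonal_system_axioms.intro finite_measureI)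
  show "emeasure (torus_measure :: (real ^ 'd) measure) (space torus_measure) \<noteq> \<infinity>"
    unfolding torus_measure_def torus_cube_eq_cbox
    by (simp add: emeasure_restrict_space space_restrict_space emeasure_lborel_cbox_eq)
  show "torus_character n \<in> borel_measurable torus_measure" for n :: "int ^ 'd"
    by (rule torus_measurableI) measurable
  show "norm (torus_character n x) \<le> 1" for n :: "int ^ 'd" and x
    by (simp add: torus_character_def)
  show "(\<integral>x. torus_character m x * cnj (torus_character n x) \<partial>(torus_measure :: (real ^ 'd) measure))
      = (if m = n then complex_of_real ((2 * pi) ^ CARD('d)) else 0)" for m n :: "int ^ 'd"
    unfolding torus_character_cnj integral_torus_character by simp
qed simp

lemma AE_sin_symbol_pos: "AE x in (torus_measure :: (real ^ 'd::finite) measure). sin_symbol x > 0"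
proof -
  have "AE x in (lborel :: (real ^ 'd) measure). x \<in> torus_cube \<longrightarrow> sin_symbol x > 0"
    using AE_vec_nth_neq[of 0] AE_vec_nth_neq[of "2 * pi"]
  proof eventually_elim
    fix x :: "real ^ 'd"
    assume "\<forall>j. x $ j \<noteq> 0" "\<forall>j. x $ j \<noteq> 2 * pi"
    then have "0 < (sin (x $ j / 2))\<^sup>2" if "x \<in> torus_cube" for j
      using that sin_half_neq_0[of "x $ j"] by (auto simp: torus_cube_def order_less_le)
    then show "x \<in> torus_cube \<longrightarrow> sin_symbol x > 0"
      unfolding sin_symbol_def by (auto intro!: sum_pos)
  qed
  then show ?thesis
    unfolding torus_measure_def by (subst AE_restrict_space_iff) auto
qed

section \<open>The lattice Dirichlet energy\<close>

text \<open>The square of \<open>grad_norm\<close>, written without roots so that it can be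
  estimated termwise.\<close>

definition energy :: "(int ^ 'd::finite \<Rightarrow> complex) \<Rightarrow> real" where
  "energy u = (\<Sum>i\<in>UNIV. \<Sum>\<^sub>\<infinity>n. (norm (lattice_diff i u n))\<^sup>2)"

lemma energy_nonneg: "0 \<le> energy u"
  unfolding energy_def by (intro sum_nonneg infsum_nonneg) auto

lemma lp_norm_2_power2: "(lp_norm 2 v)\<^sup>2 = (\<Sum>\<^sub>\<infinity>n. (norm (v n))\<^sup>2)"
proof -
  have "0 \<le> (\<Sum>\<^sub>\<infinity>n. (norm (v n))\<^sup>2)"
    by (rule infsum_nonneg) simp
  then show ?thesis
    unfolding lp_norm_def by (simp add: powr_half_sqrt)
qed

lemma grad_norm_power2: "(grad_norm u)\<^sup>2 = energy u"
  unfolding grad_norm_def energy_def lp_norm_2_power2 by (simp add: sum_nonneg infsum_nonneg)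

section \<open>The energy on the Fourier side\<close>

lemma norm_cis_minus_1_power2: "(norm (cnj (cis t) - 1))\<^sup>2 = 4 * (sin (t / 2))\<^sup>2"
proof -
  have "(norm (cnj (cis t) - 1))\<^sup>2 = (cos t - 1)\<^sup>2 + (sin t)\<^sup>2"
    by (simp add: cmod_power2)
  also have "\<dots> = 2 - 2 * cos t"
    using sin_cos_squared_add[of t] by (simp add: power2_eq_square algebra_simps)
  also have "cos t = 1 - 2 * (sin (t / 2))\<^sup>2"
    using cos_double_sin[of "t / 2"] by simp
  finally show ?thesis by simp
qed

lemma torus_character_axis: "torus_character (axis i 1) x = cis (x $ i)"
proof -
  have "(\<Sum>j\<in>UNIV. of_int (axis i 1 $ j) * x $ j) = (\<Sum>j\<in>UNIV. if j = i then x $ j else 0)"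
    by (rule sum.cong) (auto simp: axis_def)
  then show ?thesis
    by (simp add: torus_character_def)
qed

text \<open>Translating the coefficients by a unit vector multiplies the synthesis by the conjugate
  character of that vector. The set \<open>G\<close> is enlarged by a shifted copy of
  \<open>F\<close>, since the difference may be nonzero at points whose successor lies in
  \<open>F\<close>.\<close>

lemma synthesis_lattice_diff:
  fixes u :: "int ^ 'd::finite \<Rightarrow> complex" and i :: 'd
  assumes F: "finite F" and u: "\<And>n. n \<notin> F \<Longrightarrow> u n = 0"
  defines "G \<equiv> F \<union> (\<lambda>n. n - axis i 1) ` F"
  shows "(\<Sum>n\<in>G. lattice_diff i u n * torus_character n x)
    = (cnj (cis (x $ i)) - 1) * (\<Sum>n\<in>F. u n * torus_character n x)"
proof -
  have G: "finite G"
    using F by (simp add: G_def)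
  have "(\<Sum>n\<in>G. u (n + axis i 1) * torus_character n x)
      = (\<Sum>n\<in>(\<lambda>n. n - axis i 1) ` F. u (n + axis i 1) * torus_character n x)"
  proof (rule sum.mono_neutral_right[OF G], use G_def in blast, rule ballI)
    fix n assume n: "n \<in> G - (\<lambda>n. n - axis i 1) ` F"
    have "n + axis i 1 \<notin> F"
    proof
      assume "n + axis i 1 \<in> F"
      then have "(n + axis i 1) - axis i 1 \<in> (\<lambda>n. n - axis i 1) ` F"
        by (rule imageI)
      then show False using n by simp
    qed
    then show "u (n + axis i 1) * torus_character n x = 0"
      by (simp add: u)
  qed
  also have "\<dots> = (\<Sum>n\<in>F. u n * torus_character (n - axis i 1) x)"
    by (subst sum.reindex) (auto simp: inj_on_def)
  also have "\<dots> = cnj (cis (x $ i)) * (\<Sum>n\<in>F. u n * torus_character n x)"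
    by (simp add: sum_distrib_left torus_character_cnj[symmetric] torus_character_axis mult_ac)
  finally have 1: "(\<Sum>n\<in>G. u (n + axis i 1) * torus_character n x) = \<dots>" .
  have 2: "(\<Sum>n\<in>G. u n * torus_character n x) = (\<Sum>n\<in>F. u n * torus_character n x)"
    using G by (intro sum.mono_neutral_right) (auto simp: G_def u)
  show ?thesis
    unfolding lattice_diff_def left_diff_distrib sum_subtractf 1 2 by simp
qed

text \<open>Parseval for each difference \<open>lattice_diff i u\<close>, whose synthesis is that of
  \<open>u\<close> times a multiplier of squared modulus
  \<open>4 * (sin (x $ i / 2))\<^sup>2\<close>. This 4 is the source of the factor
  \<open>1 / 4\<close>.\<close>

lemma integral_sin_symbol_synthesis:
  fixes u :: "int ^ 'd::finite \<Rightarrow> complex"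
  assumes F: "finite F" and u: "\<And>n. n \<notin> F \<Longrightarrow> u n = 0"
  shows "(\<integral>x. sin_symbol x * (norm (\<Sum>n\<in>F. u n * torus_character n x))\<^sup>2 \<partial>(torus_measure :: (real ^ 'd) measure))
    = (2 * pi) ^ CARD('d) / 4 * energy u"
proof -
  define f where "f x = (\<Sum>n\<in>F. u n * torus_character n x)" for x :: "real ^ 'd"
  define G where "G i = F \<union> (\<lambda>n. n - axis i 1) ` F" for i :: 'd
  define U where "U = (\<Sum>n\<in>F. norm (u n))"
  have U: "norm (f x) \<le> U" for x
    unfolding f_def U_def by (rule torus.norm_synthesis_le)
  have [measurable]: "f \<in> borel_measurable borel"
    unfolding f_def by measurable
  have diff: "(\<Sum>n\<in>G i. lattice_diff i u n * torus_character n x) = (cnj (cis (x $ i)) - 1) * f x" for i x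
    unfolding G_def f_def by (rule synthesis_lattice_diff) fact+
  have each: "(\<integral>x. 4 * ((sin (x $ i / 2))\<^sup>2 * (norm (f x))\<^sup>2) \<partial>torus_measure)
      = (2 * pi) ^ CARD('d) * (\<Sum>\<^sub>\<infinity>n. (norm (lattice_diff i u n))\<^sup>2)" for i
  proof -
    have "(\<integral>x. 4 * ((sin (x $ i / 2))\<^sup>2 * (norm (f x))\<^sup>2) \<partial>torus_measure)
        = (\<integral>x. (norm (\<Sum>n\<in>G i. lattice_diff i u n * torus_character n x))\<^sup>2 \<partial>torus_measure)"
      unfolding diff norm_mult power_mult_distrib norm_cis_minus_1_power2 by (simp only: mult.assoc)
    also have "\<dots> = (2 * pi) ^ CARD('d) * (\<Sum>n\<in>G i. (norm (lattice_diff i u n))\<^sup>2)"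
      by (rule torus.parseval) (simp add: G_def F)
    also have "(\<Sum>n\<in>G i. (norm (lattice_diff i u n))\<^sup>2) = (\<Sum>\<^sub>\<infinity>n\<in>G i. (norm (lattice_diff i u n))\<^sup>2)"
      by (rule infsum_finite[symmetric]) (simp add: G_def F)
    also have "\<dots> = (\<Sum>\<^sub>\<infinity>n. (norm (lattice_diff i u n))\<^sup>2)"
    proof (rule infsum_cong_neutral)
      fix n assume "n \<in> UNIV - G i"
      then have "n \<notin> F" "n + axis i 1 \<notin> F"
        by (auto simp: G_def image_iff algebra_simps)
      then show "(norm (lattice_diff i u n))\<^sup>2 = 0"
        by (simp add: lattice_diff_def u)
    qed auto
    finally show ?thesis .
  qed
  have int: "integrable torus_measure (\<lambda>x. (sin (x $ i / 2))\<^sup>2 * (norm (f x))\<^sup>2)" for i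
  proof (rule torus.integrable_bounded[where B="1 * U\<^sup>2"])
    show "norm ((sin (x $ i / 2))\<^sup>2 * (norm (f x))\<^sup>2) \<le> 1 * U\<^sup>2" for x
      unfolding norm_mult using U[of x]
      by (intro mult_mono) (auto simp: abs_square_le_1 intro!: power_mono)
    show "(\<lambda>x. (sin (x $ i / 2))\<^sup>2 * (norm (f x))\<^sup>2) \<in> borel_measurable torus_measure"
      by (rule torus_measurableI) measurable
  qed
  have "(\<integral>x. sin_symbol x * (norm (f x))\<^sup>2 \<partial>torus_measure)
      = (\<Sum>i\<in>UNIV. \<integral>x. (sin (x $ i / 2))\<^sup>2 * (norm (f x))\<^sup>2 \<partial>torus_measure)"
    unfolding sin_symbol_def sum_distrib_right using int by (intro Bochner_Integration.integral_sum)
  also have "\<dots> = (\<Sum>i\<in>UNIV. (2 * pi) ^ CARD('d) / 4 * (\<Sum>\<^sub>\<infinity>n. (norm (lattice_diff i u n))\<^sup>2))"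
    using each by (intro sum.cong refl) (simp add: field_simps)
  finally show ?thesis
    unfolding f_def energy_def by (simp add: sum_distrib_left)
qed

text \<open>The abstract bound with \<open>E\<close> equal to \<open>V / 4 * G\<close>; the factors
  4 cancel. The slack in \<open>G\<close> and \<open>K\<close> keeps both positive and leaves room
  for the later limit.\<close>

lemma finite_support_sum_powr_le:
  fixes u :: "int ^ 'd::finite \<Rightarrow> complex"
  assumes F: "finite F" and u: "\<And>n. n \<notin> F \<Longrightarrow> u n = 0"
    and p: "p > 1" and q: "q = p / (p - 1)" "q < CARD('d) / 2"
    and G: "energy u \<le> G" "0 < G"
    and K: "(LINT x:(torus_cube :: (real ^ 'd) set)|lborel. symbol_integrand q x) \<le> K" "0 < K"
  shows "(\<Sum>n\<in>F. norm (u n) powr (2 * p)) \<le> q * (G * K / (2 * pi) ^ CARD('d)) powr (p - 1) * G"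
proof -
  define V where "V = (2 * pi) ^ CARD('d)"
  have V: "V > 0"
    by (simp add: V_def)
  have sym: "symbol_integrand q = (\<lambda>x :: real ^ 'd. 1 / sin_symbol x powr (p / (p - 1)))"
    by (simp add: fun_eq_iff symbol_integrand_def sin_symbol_def q(1))
  have q0: "0 < q"
    using p q(1) by simp
  have "(\<Sum>n\<in>F. norm (u n) powr (2 * p))
    \<le> 4 * (p / (p - 1)) / V * (4 * (V / 4 * G) * K / V\<^sup>2) powr (p - 1) * (V / 4 * G)"
    unfolding V_def
  proof (rule torus.sum_powr_le[OF F p _ K(2) refl])
    show "0 < (2 * pi) ^ CARD('d) / 4 * G"
      using G by simp
    show "sin_symbol \<in> borel_measurable (torus_measure :: (real ^ 'd) measure)"
      by (rule torus_measurableI) measurable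
    show "0 \<le> sin_symbol x" for x :: "real ^ 'd"
      by (simp add: sin_symbol_def sum_nonneg)
    show "sin_symbol x \<le> CARD('d)" for x :: "real ^ 'd"
      unfolding sin_symbol_def using sum_bounded_above[of UNIV "\<lambda>j. (sin (x $ j / 2))\<^sup>2" 1]
      by (simp add: abs_square_le_1)
    show "AE x in (torus_measure :: (real ^ 'd) measure). 0 < sin_symbol x"
      by (rule AE_sin_symbol_pos)
    show "(\<integral>x. sin_symbol x * (norm (\<Sum>n\<in>F. u n * torus_character n x))\<^sup>2 \<partial>(torus_measure :: (real ^ 'd) measure))
        \<le> (2 * pi) ^ CARD('d) / 4 * G"
    proof (subst integral_sin_symbol_synthesis[OF F u])
      show "(2 * pi) ^ CARD('d) / 4 * energy u \<le> (2 * pi) ^ CARD('d) / 4 * G"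
        using G by (intro mult_left_mono) auto
    qed
    show "integrable torus_measure (\<lambda>x :: real ^ 'd. 1 / sin_symbol x powr (p / (p - 1)))"
      using set_integrable_symbol_integrand[OF q0 q(2)] unfolding integrable_torus_measure_iff sym .
    show "(\<integral>x. 1 / sin_symbol x powr (p / (p - 1)) \<partial>(torus_measure :: (real ^ 'd) measure)) \<le> K"
      using K(1) unfolding integral_torus_measure sym .
  qed
  also have "4 * (V / 4 * G) * K / V\<^sup>2 = G * K / V"
    using V by (simp add: power2_eq_square)
  also have "4 * (p / (p - 1)) / V * (G * K / V) powr (p - 1) * (V / 4 * G) = q * (G * K / V) powr (p - 1) * G"
    unfolding q(1)[symmetric] using V by simp
  finally show ?thesis
    unfolding V_def .
qed

section \<open>Passage from finite support to square-summable functions\<close>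

text \<open>Young's inequality for the cross term. The weight \<open>\<epsilon>\<close> keeps the
  coefficient of the main term near 1 and moves the loss to \<open>b\<close>, which will be a small
  tail.\<close>

lemma norm_diff_power2_le:
  fixes a b :: "'a::real_normed_vector"
  assumes "\<epsilon> > 0"
  shows "(norm (a - b))\<^sup>2 \<le> (1 + \<epsilon>) * (norm a)\<^sup>2 + (1 + 1 / \<epsilon>) * (norm b)\<^sup>2"
proof -
  have "(norm (a - b))\<^sup>2 \<le> (norm a + norm b)\<^sup>2"
    by (intro power_mono norm_triangle_ineq4) simp
  also have "2 * norm a * norm b \<le> \<epsilon> * (norm a)\<^sup>2 + 1 / \<epsilon> * (norm b)\<^sup>2"
    using assms zero_le_power2[of "\<epsilon> * norm a - norm b"] by (simp add: power2_eq_square field_simps)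
  then have "(norm a + norm b)\<^sup>2 \<le> (1 + \<epsilon>) * (norm a)\<^sup>2 + (1 + 1 / \<epsilon>) * (norm b)\<^sup>2"
    by (simp add: power2_eq_square algebra_simps)
  finally show ?thesis .
qed

lemma bij_add_axis: "bij (\<lambda>n :: int ^ 'd::finite. n + axis i 1)"
  by (rule bij_betw_byWitness[where f'="\<lambda>n. n - axis i 1"]) auto

lemma
  fixes v :: "int ^ 'd::finite \<Rightarrow> complex"
  assumes v: "(\<lambda>n. (norm (v n))\<^sup>2) summable_on UNIV"
  shows summable_lattice_diff: "(\<lambda>n. (norm (lattice_diff i v n))\<^sup>2) summable_on UNIV"
    and infsum_lattice_diff_le: "(\<Sum>\<^sub>\<infinity>n. (norm (lattice_diff i v n))\<^sup>2) \<le> 4 * (\<Sum>\<^sub>\<infinity>n. (norm (v n))\<^sup>2)"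
proof -
  have shift: "(\<lambda>n. (norm (v (n + axis i 1)))\<^sup>2) summable_on UNIV"
    using summable_on_reindex_bij_betw[OF bij_add_axis, of "\<lambda>n. (norm (v n))\<^sup>2" i] v by simp
  have shift_eq: "(\<Sum>\<^sub>\<infinity>n. (norm (v (n + axis i 1)))\<^sup>2) = (\<Sum>\<^sub>\<infinity>n. (norm (v n))\<^sup>2)"
    using infsum_reindex_bij_betw[OF bij_add_axis, of "\<lambda>n. (norm (v n))\<^sup>2" i] by simp
  have sum: "(\<lambda>n. 2 * (norm (v (n + axis i 1)))\<^sup>2 + 2 * (norm (v n))\<^sup>2) summable_on UNIV"
    by (intro summable_on_add summable_on_cmult_right shift v)
  have le: "(norm (lattice_diff i v n))\<^sup>2 \<le> 2 * (norm (v (n + axis i 1)))\<^sup>2 + 2 * (norm (v n))\<^sup>2" for n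
    using norm_diff_power2_le[of 1] by (simp add: lattice_diff_def)
  show *: "(\<lambda>n. (norm (lattice_diff i v n))\<^sup>2) summable_on UNIV"
    by (rule summable_on_comparison_test[OF sum]) (use le in auto)
  have "(\<Sum>\<^sub>\<infinity>n. (norm (lattice_diff i v n))\<^sup>2)
      \<le> (\<Sum>\<^sub>\<infinity>n. 2 * (norm (v (n + axis i 1)))\<^sup>2 + 2 * (norm (v n))\<^sup>2)"
    by (rule infsum_mono[OF * sum le])
  also have "\<dots> = 4 * (\<Sum>\<^sub>\<infinity>n. (norm (v n))\<^sup>2)"
    by (subst infsum_add) (auto simp: infsum_cmult_right' shift_eq intro!: summable_on_cmult_right shift v)
  finally show "(\<Sum>\<^sub>\<infinity>n. (norm (lattice_diff i v n))\<^sup>2) \<le> 4 * (\<Sum>\<^sub>\<infinity>n. (norm (v n))\<^sup>2)" .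
qed

lemma energy_diff_le:
  fixes u v :: "int ^ 'd::finite \<Rightarrow> complex"
  assumes u: "(\<lambda>n. (norm (u n))\<^sup>2) summable_on UNIV"
    and v: "(\<lambda>n. (norm (v n))\<^sup>2) summable_on UNIV"
    and \<epsilon>: "\<epsilon> > 0"
  shows "energy (\<lambda>n. u n - v n) \<le> (1 + \<epsilon>) * energy u + (1 + 1 / \<epsilon>) * (4 * CARD('d) * (\<Sum>\<^sub>\<infinity>n. (norm (v n))\<^sup>2))"
proof -
  define T where "T = (\<Sum>\<^sub>\<infinity>n. (norm (v n))\<^sup>2)"
  have each: "(\<Sum>\<^sub>\<infinity>n. (norm (lattice_diff i (\<lambda>n. u n - v n) n))\<^sup>2)
      \<le> (1 + \<epsilon>) * (\<Sum>\<^sub>\<infinity>n. (norm (lattice_diff i u n))\<^sup>2) + (1 + 1 / \<epsilon>) * (4 * T)" for i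
  proof -
    have le: "(norm (lattice_diff i (\<lambda>n. u n - v n) n))\<^sup>2
        \<le> (1 + \<epsilon>) * (norm (lattice_diff i u n))\<^sup>2 + (1 + 1 / \<epsilon>) * (norm (lattice_diff i v n))\<^sup>2" for n
    proof -
      have "lattice_diff i (\<lambda>n. u n - v n) n = lattice_diff i u n - lattice_diff i v n"
        by (simp add: lattice_diff_def)
      then show ?thesis
        using norm_diff_power2_le[OF \<epsilon>] by metis
    qed
    have sums: "(\<lambda>n. (1 + \<epsilon>) * (norm (lattice_diff i u n))\<^sup>2) summable_on UNIV"
        "(\<lambda>n. (1 + 1 / \<epsilon>) * (norm (lattice_diff i v n))\<^sup>2) summable_on UNIV"
      by (intro summable_on_cmult_right summable_lattice_diff u v)+
    note sum = summable_on_add[OF sums]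
    have "(\<Sum>\<^sub>\<infinity>n. (norm (lattice_diff i (\<lambda>n. u n - v n) n))\<^sup>2)
        \<le> (\<Sum>\<^sub>\<infinity>n. (1 + \<epsilon>) * (norm (lattice_diff i u n))\<^sup>2 + (1 + 1 / \<epsilon>) * (norm (lattice_diff i v n))\<^sup>2)"
      by (rule infsum_mono[OF summable_on_comparison_test[OF sum] sum]) (use le in auto)
    also have "\<dots> = (1 + \<epsilon>) * (\<Sum>\<^sub>\<infinity>n. (norm (lattice_diff i u n))\<^sup>2)
        + (1 + 1 / \<epsilon>) * (\<Sum>\<^sub>\<infinity>n. (norm (lattice_diff i v n))\<^sup>2)"
      using infsum_add[OF sums] by (simp add: infsum_cmult_right')
    also have "\<dots> \<le> (1 + \<epsilon>) * (\<Sum>\<^sub>\<infinity>n. (norm (lattice_diff i u n))\<^sup>2) + (1 + 1 / \<epsilon>) * (4 * T)"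
      unfolding T_def using \<epsilon> infsum_lattice_diff_le[OF v, of i] by (intro add_left_mono mult_left_mono) auto
    finally show ?thesis .
  qed
  have "energy (\<lambda>n. u n - v n) \<le> (\<Sum>i\<in>(UNIV :: 'd set). (1 + \<epsilon>) * (\<Sum>\<^sub>\<infinity>n. (norm (lattice_diff i u n))\<^sup>2) + (1 + 1 / \<epsilon>) * (4 * T))"
    unfolding energy_def by (rule sum_mono) (rule each)
  also have "\<dots> = (1 + \<epsilon>) * energy u + (1 + 1 / \<epsilon>) * (4 * CARD('d) * T)"
    unfolding energy_def sum.distrib sum_distrib_left by simp
  finally show ?thesis
    unfolding T_def .
qed

text \<open>Prescribing \<open>F0\<close> makes the truncation agree with the original function on a
  given finite set.\<close>

lemma ex_finite_small_tail:
  fixes f :: "'a \<Rightarrow> real"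
  assumes f: "f summable_on UNIV" and F0: "finite F0" and \<delta>: "\<delta> > 0"
  obtains F where "finite F" "F0 \<subseteq> F" "(\<Sum>\<^sub>\<infinity>n. if n \<in> F then 0 else f n) < \<delta>"
proof -
  have "(sum f \<longlongrightarrow> infsum f UNIV) (finite_subsets_at_top UNIV)"
    using has_sum_infsum[OF f] by (simp add: has_sum_def)
  then have "eventually (\<lambda>F. dist (sum f F) (infsum f UNIV) < \<delta>) (finite_subsets_at_top UNIV)"
    using \<delta> by (rule tendstoD)
  then obtain X where X: "finite X" "\<And>Y. finite Y \<Longrightarrow> X \<subseteq> Y \<Longrightarrow> dist (sum f Y) (infsum f UNIV) < \<delta>"
    unfolding eventually_finite_subsets_at_top by auto
  define F where "F = F0 \<union> X"
  have F: "finite F" "F0 \<subseteq> F" "X \<subseteq> F"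
    using F0 X by (auto simp: F_def)
  have "(\<Sum>\<^sub>\<infinity>n. if n \<in> F then 0 else f n) = infsum f (UNIV - F)"
    by (rule infsum_cong_neutral) auto
  also have "\<dots> = infsum f UNIV - sum f F"
    using F f by (subst infsum_Diff) auto
  also have "\<dots> < \<delta>"
    using X(2)[OF F(1,3)] by (simp add: dist_real_def)
  finally show ?thesis
    using that F by blast
qed

text \<open>Truncating \<open>u\<close> to a large finite set containing \<open>F0\<close> leaves
  the sum over \<open>F0\<close> unchanged and raises the energy only slightly; then
  \<open>\<epsilon>\<close> tends to 0. A bound uniform in \<open>F0\<close> will also deliver
  summability.\<close>

lemma lattice_sum_powr_le:
  fixes u :: "int ^ 'd::finite \<Rightarrow> complex"
  assumes F0: "finite F0" and u: "(\<lambda>n. (norm (u n))\<^sup>2) summable_on UNIV"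
    and p: "p > 1" and q: "q = p / (p - 1)" "q < CARD('d) / 2"
  defines "K \<equiv> (LINT x:(torus_cube :: (real ^ 'd) set)|lborel. symbol_integrand q x)"
  shows "(\<Sum>n\<in>F0. norm (u n) powr (2 * p)) \<le> q * (energy u * K / (2 * pi) ^ CARD('d)) powr (p - 1) * energy u"
proof (rule tendsto_lowerbound)
  define \<Phi> where "\<Phi> \<epsilon> = q * (((1 + \<epsilon>) * energy u + \<epsilon>) * (K + \<epsilon>) / (2 * pi) ^ CARD('d)) powr (p - 1) * ((1 + \<epsilon>) * energy u + \<epsilon>)" for \<epsilon>
  have K0: "0 \<le> K"
    unfolding K_def set_lebesgue_integral_def by (intro integral_nonneg_AE) (simp add: symbol_integrand_def)
  have pos: "eventually (\<lambda>\<epsilon>::real. \<epsilon> > 0) (at_right 0)"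
    by (rule eventually_at_right_less)
  show "(\<Phi> \<longlongrightarrow> q * (energy u * K / (2 * pi) ^ CARD('d)) powr (p - 1) * energy u) (at_right 0)"
  proof -
    have G: "((\<lambda>\<epsilon>. (1 + \<epsilon>) * energy u + \<epsilon>) \<longlongrightarrow> energy u) (at_right 0)"
      by (rule tendsto_eq_intros refl | simp)+
    have KK: "((\<lambda>\<epsilon>. K + \<epsilon>) \<longlongrightarrow> K) (at_right 0)"
      by (rule tendsto_eq_intros refl | simp)+
    have "((\<lambda>\<epsilon>. (((1 + \<epsilon>) * energy u + \<epsilon>) * (K + \<epsilon>) / (2 * pi) ^ CARD('d)) powr (p - 1))
        \<longlongrightarrow> (energy u * K / (2 * pi) ^ CARD('d)) powr (p - 1)) (at_right 0)"
    \<comment> \<open>The limiting base is 0 when \<open>u\<close> vanishes; continuity of the power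
      then relies on \<open>p - 1 > 0\<close> and a nonnegative base.\<close>
    proof (rule tendsto_powr')
      show "((\<lambda>\<epsilon>. ((1 + \<epsilon>) * energy u + \<epsilon>) * (K + \<epsilon>) / (2 * pi) ^ CARD('d))
          \<longlongrightarrow> energy u * K / (2 * pi) ^ CARD('d)) (at_right 0)"
        by (intro tendsto_divide tendsto_mult G KK tendsto_const) simp
      have "eventually (\<lambda>\<epsilon>. 0 \<le> ((1 + \<epsilon>) * energy u + \<epsilon>) * (K + \<epsilon>) / (2 * pi) ^ CARD('d)) (at_right 0)"
        using pos by eventually_elim (use K0 energy_nonneg[of u] in simp)
      then show "energy u * K / (2 * pi) ^ CARD('d) \<noteq> 0 \<or> 0 < p - 1 \<and>
          (\<forall>\<^sub>F \<epsilon> in at_right 0. 0 \<le> ((1 + \<epsilon>) * energy u + \<epsilon>) * (K + \<epsilon>) / (2 * pi) ^ CARD('d))"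
        using p by simp
    qed (rule tendsto_const)
    then show ?thesis
      unfolding \<Phi>_def by (intro tendsto_mult tendsto_const G)
  qed
  show "eventually (\<lambda>\<epsilon>. (\<Sum>n\<in>F0. norm (u n) powr (2 * p)) \<le> \<Phi> \<epsilon>) (at_right 0)"
    using pos
  proof eventually_elim
    fix \<epsilon> :: real assume \<epsilon>: "\<epsilon> > 0"
    \<comment> \<open>A tail of square sum \<open>\<delta>\<close> adds exactly
      \<open>\<epsilon>\<close> to the bound in \<open>energy_diff_le\<close>.\<close>
    define \<delta> where "\<delta> = \<epsilon> / ((1 + 1 / \<epsilon>) * (4 * CARD('d)))"
    have \<delta>: "0 < \<delta>"
      unfolding \<delta>_def using \<epsilon> by (intro divide_pos_pos mult_pos_pos add_pos_pos) auto
    obtain F where F: "finite F" "F0 \<subseteq> F"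
      and tail: "(\<Sum>\<^sub>\<infinity>n. if n \<in> F then 0 else (norm (u n))\<^sup>2) < \<delta>"
      using ex_finite_small_tail[OF u F0 \<delta>] by metis
    define v where "v n = (if n \<in> F then 0 else u n)" for n
    define w where "w n = u n - v n" for n
    have v2: "(norm (v n))\<^sup>2 = (if n \<in> F then 0 else (norm (u n))\<^sup>2)" for n
      by (simp add: v_def)
    have v: "(\<lambda>n. (norm (v n))\<^sup>2) summable_on UNIV"
      by (rule summable_on_comparison_test[OF u]) (auto simp: v2)
    have "energy w \<le> (1 + \<epsilon>) * energy u + (1 + 1 / \<epsilon>) * (4 * CARD('d) * (\<Sum>\<^sub>\<infinity>n. (norm (v n))\<^sup>2))"
      unfolding w_def by (rule energy_diff_le[OF u v \<epsilon>])
    also have "(1 + 1 / \<epsilon>) * (4 * CARD('d) * (\<Sum>\<^sub>\<infinity>n. (norm (v n))\<^sup>2)) \<le> (1 + 1 / \<epsilon>) * (4 * CARD('d) * \<delta>)"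
      using tail \<epsilon> unfolding v2 by (intro mult_left_mono) auto
    also have "\<dots> = \<epsilon>"
    proof -
      have "(1 + 1 / \<epsilon>) * (4 * CARD('d)) \<noteq> 0"
        using \<epsilon> by (simp add: add_pos_pos less_imp_neq[symmetric])
      then show ?thesis
        unfolding \<delta>_def mult.assoc[symmetric] by simp
    qed
    finally have energy: "energy w \<le> (1 + \<epsilon>) * energy u + \<epsilon>"
      by simp
    have "(\<Sum>n\<in>F0. norm (u n) powr (2 * p)) = (\<Sum>n\<in>F0. norm (w n) powr (2 * p))"
      using F by (intro sum.cong) (auto simp: w_def v_def)
    also have "\<dots> \<le> (\<Sum>n\<in>F. norm (w n) powr (2 * p))"
      using F by (intro sum_mono2) auto
    also have "\<dots> \<le> \<Phi> \<epsilon>"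
      unfolding \<Phi>_def
    proof (rule finite_support_sum_powr_le[OF F(1) _ p q energy])
      show "w n = 0" if "n \<notin> F" for n
        using that by (simp add: w_def v_def)
      show "0 < (1 + \<epsilon>) * energy u + \<epsilon>"
        using \<epsilon> energy_nonneg[of u] by (simp add: add_nonneg_pos)
    qed (use \<epsilon> K0 K_def in auto)
    finally show "(\<Sum>n\<in>F0. norm (u n) powr (2 * p)) \<le> \<Phi> \<epsilon>" .
  qed
qed simp

section \<open>Comparison of the constants\<close>

text \<open>With \<open>V = (2 * pi) powr d\<close> and \<open>1 / q + (p + 1) / p = 2\<close>, the
  claim reduces to \<open>q powr (1 / p) \<le> V\<^sup>2 / 4\<close>. This holds since
  \<open>q < d / 2\<close>, \<open>d \<le> V\<close> and \<open>2 \<le> V\<close>.\<close>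

lemma constant_le:
  fixes p q V G K :: real and d :: nat
  assumes p: "p > 1" and q: "q = p / (p - 1)" "q < d / 2" and d: "d > 0"
    and G: "0 \<le> G" and K: "0 \<le> K"
  shows "(q * (G * K / (2 * pi) ^ d) powr (p - 1) * G) powr (1 / p)
    \<le> 1 / 4 * (2 * pi) powr (d * (p + 1) / p) * K powr (1 / q) * G"
proof -
  define V where "V = (2 * pi) powr d"
  have V: "(2 * pi) ^ d = V"
    by (simp add: V_def powr_realpow)
  have V0: "V > 0"
    by (simp add: V_def)
  have q1: "1 \<le> q"
    using p q(1) by simp
  have pq: "(p - 1) * (1 / p) = 1 / q" "1 / q + 1 / p = 1"
    unfolding q(1) using p by (simp_all add: field_simps)
  have GG: "G powr (1 / q) * G powr (1 / p) = G"
    using G by (cases "G = 0") (simp_all add: powr_add[symmetric] pq(2))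
  have "(q * (G * K / V) powr (p - 1) * G) powr (1 / p)
      = q powr (1 / p) * ((G * K / V) powr (p - 1)) powr (1 / p) * G powr (1 / p)"
    by (simp add: powr_mult)
  also have "((G * K / V) powr (p - 1)) powr (1 / p) = G powr (1 / q) * K powr (1 / q) / V powr (1 / q)"
    unfolding powr_powr pq(1) by (simp add: powr_mult powr_divide)
  also have "q powr (1 / p) * (G powr (1 / q) * K powr (1 / q) / V powr (1 / q)) * G powr (1 / p)
      = q powr (1 / p) / V powr (1 / q) * K powr (1 / q) * (G powr (1 / q) * G powr (1 / p))"
    by simp
  also have "\<dots> = q powr (1 / p) / V powr (1 / q) * K powr (1 / q) * G"
    unfolding GG ..
  also have "\<dots> \<le> 1 / 4 * V powr ((p + 1) / p) * K powr (1 / q) * G"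
  proof (intro mult_right_mono)
    have "real d \<le> 2 ^ d"
      using of_nat_less_two_power[of d] by (simp add: less_imp_le)
    also have "(2::real) ^ d \<le> (2 * pi) ^ d"
      using pi_gt3 by (intro power_mono) auto
    finally have dV: "real d \<le> V"
      unfolding V .
    have "2 ^ 1 \<le> (2 * pi) ^ d"
      using pi_gt3 d by (intro order_trans[OF power_increasing[of 1 d 2] power_mono]) auto
    then have V2: "2 \<le> V"
      unfolding V by simp
    have "q powr (1 / p) \<le> q powr 1"
      using q1 p by (intro powr_mono) auto
    also have "\<dots> \<le> V / 2"
      using q(2) q1 dV by simp
    also have "\<dots> \<le> V\<^sup>2 / 4"
      using mult_right_mono[OF V2, of V] V0 by (simp add: power2_eq_square)
    also have "V\<^sup>2 = V powr (1 / q) * V powr ((p + 1) / p)"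
    proof -
      have "1 / q + (p + 1) / p = 2"
        using p pq(2) by (simp add: field_simps)
      then show ?thesis
        using V0 by (simp add: powr_add[symmetric])
    qed
    finally show "q powr (1 / p) / V powr (1 / q) \<le> 1 / 4 * V powr ((p + 1) / p)"
      using V0 by (simp add: field_simps)
  qed (use G in simp_all)
  also have "V powr ((p + 1) / p) = (2 * pi) powr (d * (p + 1) / p)"
    unfolding V_def powr_powr by simp
  finally show ?thesis
    unfolding V .
qed

theorem theorem6p2:
  fixes p :: real and u :: "int ^ 'd::finite \<Rightarrow> complex"
  assumes d: "CARD('d) \<ge> 3"
    and p: "2 * p > 2 * real CARD('d) / (real CARD('d) - 2)"
    and u: "u \<in> lp_space 2"
  shows "set_integrable lborel (torus_cube :: (real ^ 'd) set) (symbol_integrand (p / (p - 1)))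
    \<and> u \<in> lp_space (2 * p)
    \<and> (lp_norm (2 * p) u)\<^sup>2 = (\<Sum>\<^sub>\<infinity>n. norm (u n) powr (2 * p)) powr (1 / p)
    \<and> (\<Sum>\<^sub>\<infinity>n. norm (u n) powr (2 * p)) powr (1 / p)
        \<le> 1 / 4 * (2 * pi) powr (real CARD('d) * (p + 1) / p)
            * I_const (p / (p - 1)) TYPE('d) * (grad_norm u)\<^sup>2"
proof (intro conjI)
  define q where "q = p / (p - 1)"
  define K where "K = (LINT x:(torus_cube :: (real ^ 'd) set)|lborel. symbol_integrand q x)"
  define B where "B = q * (energy u * K / (2 * pi) ^ CARD('d)) powr (p - 1) * energy u"
  \<comment> \<open>The hypothesis on \<open>p\<close> without denominators; for
    \<open>p > 1\<close> it is equivalent to \<open>q < CARD('d) / 2\<close>, the condition for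
    integrability.\<close>
  have pd: "real CARD('d) < p * (real CARD('d) - 2)"
    using d p by (simp add: field_simps)
  have p1: "p > 1"
  proof (rule ccontr)
    assume "\<not> p > 1"
    then have "p * (real CARD('d) - 2) \<le> 1 * (real CARD('d) - 2)"
      using d by (intro mult_right_mono) auto
    then show False using pd by simp
  qed
  have q: "0 < q" "q < CARD('d) / 2"
    using pd p1 by (simp_all add: q_def field_simps)
  have u2: "(\<lambda>n. (norm (u n))\<^sup>2) summable_on UNIV"
    using u by (simp add: lp_space_def)
  have K: "0 \<le> K"
    unfolding K_def set_lebesgue_integral_def by (intro integral_nonneg_AE) (simp add: symbol_integrand_def)
  \<comment> \<open>The bound does not depend on \<open>F\<close>, so it gives both membership in
    \<open>lp_space (2 * p)\<close> and the estimate of the infinite sum.\<close>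
  have le: "(\<Sum>n\<in>F. norm (u n) powr (2 * p)) \<le> B" if "finite F" for F
    unfolding B_def K_def by (rule lattice_sum_powr_le[OF that u2 p1 q_def q(2)])
  show "set_integrable lborel (torus_cube :: (real ^ 'd) set) (symbol_integrand (p / (p - 1)))"
    using set_integrable_symbol_integrand[OF q] unfolding q_def .
  have summable: "(\<lambda>n. norm (u n) powr (2 * p)) summable_on UNIV"
    by (rule nonneg_bdd_above_summable_on) (auto intro!: bdd_aboveI[where M=B] le)
  then show "u \<in> lp_space (2 * p)"
    by (simp add: lp_space_def)
  show "(lp_norm (2 * p) u)\<^sup>2 = (\<Sum>\<^sub>\<infinity>n. norm (u n) powr (2 * p)) powr (1 / p)"
    unfolding lp_norm_def power2_eq_square powr_add[symmetric] by simp
  have "(\<Sum>\<^sub>\<infinity>n. norm (u n) powr (2 * p)) \<le> B"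
    by (rule infsum_le_finite_sums[OF summable]) (rule le)
  then have "(\<Sum>\<^sub>\<infinity>n. norm (u n) powr (2 * p)) powr (1 / p) \<le> B powr (1 / p)"
    using p1 by (intro powr_mono2 infsum_nonneg) auto
  also have "\<dots> \<le> 1 / 4 * (2 * pi) powr (real CARD('d) * (p + 1) / p) * K powr (1 / q) * energy u"
    unfolding B_def by (rule constant_le[OF p1 q_def q(2) _ energy_nonneg K]) simp
  also have "K powr (1 / q) = I_const (p / (p - 1)) TYPE('d)"
    by (simp add: I_const_def K_def q_def)
  finally show "(\<Sum>\<^sub>\<infinity>n. norm (u n) powr (2 * p)) powr (1 / p)
        \<le> 1 / 4 * (2 * pi) powr (real CARD('d) * (p + 1) / p)
            * I_const (p / (p - 1)) TYPE('d) * (grad_norm u)\<^sup>2"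
    unfolding grad_norm_power2 .
qed

end
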